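(* Let $x(t)$ evolve by the ODE $\frac{\mathrm d}{\mathrm dt}x=f(x)$, $x(0)=x_0$, where $f\in C^1(\mathcal B,\mathbb R^n)$ and $\mathcal B\subset\mathbb R^n$ is forward invariant. For $k\in\{1,\dots,n\}$ and $B\in\mathbb R$ let $m^B_k(x,w^k)=Df^{[k]}(x)w^k-Bw^k$ for $(x,w^k)\in\mathcal B\times\mathbb R^{\binom nk}$. 1. Suppose each trajectory $x(t)$ in $\mathcal B$ is bounded for $t\ge0$. For each $k\in\{1,\dots,n\}$, $$\sup_{x_0\in\mathcal B}M_k(x_0)\le\inf B,\qquad( * )$$ where the infimum is over all $B\in\mathbb R$ for which there exists $V\in C^1\big(\mathcal B\times\mathbb R^{\binom nk}\big)$ satisfying $$V\ge|w^k|^2\quad\text{and}\quad f\cdot D_xV+m^B_k\cdot D_{w^k}V\le0\quad\text{for all }(x,w^k)\in\mathcal B\times\mathbb R^{\binom nk}.$$ 2. Suppose $\mathcal B$ is compact and $f\in C^2(\mathcal B,\mathbb R^n)$. Then $( * )$ holds with equality between the supremum and the infimum, including when the functions $V$ are restricted to the form $V(x,w^k)=(w^k)^{\mathsf T}U(x)w^k$ with $U\in C^1\big(\mathcal B,\mathbb R^{\binom nk\times\binom nk}\big)$.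
   Context: $\mathcal B$ may be all of $\mathbb R^n$, a subdomain of $\mathbb R^n$, or a lower-dimensional manifold embedded in $\mathbb R^n$; forward invariant means trajectories starting in $\mathcal B$ remain in $\mathcal B$ for all $t\ge0$. $Df(x)$ is the $n\times n$ Jacobian. $\mathbb S^{m-1}=\{z\in\mathbb R^m:|z|=1\}$. $D_xV$, $D_{w^k}V$ are the gradients of $V(x,w^k)$ in each argument. For $A\in\mathbb R^{n\times n}$, the $k$th multiplicative compound $A^{(k)}\in\mathbb R^{\binom nk\times\binom nk}$ is the matrix of all $k\times k$ minors of $A$, rows and columns indexed by increasing $k$-tuples from $\{1,\dots,n\}$ in lexicographic order. The $k$th additive compound is $A^{[k]}=\frac{\mathrm d}{\mathrm d\delta}(I+\delta A)^{(k)}\big|_{\delta=0}$. $Df^{[k]}(x)$ denotes the $k$th additive compound of $Df(x)$. Along a trajectory $x(t)$ from $x_0$, let $y^k(t)\in\mathbb R^{\binom nk}$ solve $\frac{\mathrm d}{\mathrm dt}y^k=Df^{[k]}(x(t))\,y^k$, $y^k(0)=y^k_0$. The sum of the $k$ leading Lyapunov exponents is $$M_k(x_0)=\sup_{y_0^k\in\mathbb S^{\binom nk-1}}\ \limsup_{t\to\infty}\frac1t\log|y^k(t)|.$$ *)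

theory Defs
  imports
    "HOL-Analysis.Analysis"
    "HOL-Library.List_Lexorder"
    "Jordan_Normal_Form.Determinant"
begin

hide_const (open) Matrix.mat Matrix.vec Matrix.row Matrix.col Matrix.rows Matrix.cols
  Determinant.det Matrix.scalar_prod
no_notation Matrix.vec_index (infixl \<open>$\<close> 100)
no_notation Matrix.scalar_prod (infix \<open>\<bullet>\<close> 70)

section \<open>Compound matrices\<close>

text \<open>
  Strictly increasing \<open>k\<close>-tuples are lists. The linear order on lists used by
  \<^const>\<open>sorted_list_of_set\<close> is the lexicographic one from
  \<^theory>\<open>HOL-Library.List_Lexorder\<close>. The type \<open>'n\<close>, with its linear order, stands for
  \<open>{1,\<dots>,n}\<close>; the type \<open>'m\<close> indexes the compounds and has to satisfy
  \<open>CARD('m) = CARD('n) choose k\<close>. Its \<open>p\<close>-th smallest element is the index of the \<open>p\<close>-th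
  tuple.
\<close>

definition increasing_tuples :: "nat \<Rightarrow> 'n::{finite,linorder} list set" where
  "increasing_tuples k = {xs. length xs = k \<and> sorted_wrt (<) xs}"

definition lex_tuple :: "nat \<Rightarrow> 'm::{finite,linorder} \<Rightarrow> 'n::{finite,linorder} list" where
  "lex_tuple k i = sorted_list_of_set (increasing_tuples k) ! card {..<i}"

definition minor :: "real^'n^'n \<Rightarrow> 'n list \<Rightarrow> 'n list \<Rightarrow> real" where
  "minor A xs ys =
     Determinant.det (Matrix.mat (length xs) (length ys) (\<lambda>(a, b). A $ (xs ! a) $ (ys ! b)))"

definition mult_compound ::
  "nat \<Rightarrow> real^'n::{finite,linorder}^'n::{finite,linorder} \<Rightarrow> real^'m::{finite,linorder}^'m::{finite,linorder}" where
  "mult_compound k A = (\<chi> i j. minor A (lex_tuple k i) (lex_tuple k j))"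

definition add_compound ::
  "nat \<Rightarrow> real^'n::{finite,linorder}^'n::{finite,linorder} \<Rightarrow> real^'m::{finite,linorder}^'m::{finite,linorder}" where
  "add_compound k A =
     vector_derivative (\<lambda>\<delta>. mult_compound k (Finite_Cartesian_Product.mat 1 + \<delta> *\<^sub>R A)) (at 0)"

definition Df_compound ::
  "nat \<Rightarrow> (real^'n::{finite,linorder} \<Rightarrow> real^'n::{finite,linorder}) \<Rightarrow> real^'n::{finite,linorder} \<Rightarrow> real^'m::{finite,linorder}^'m::{finite,linorder}" where
  "Df_compound k f x = add_compound k (jacobian f (at x))"

section \<open>Smooth functions on arbitrary sets\<close>

text \<open>
  A function is \<open>C\<^sup>1\<close> (\<open>C\<^sup>2\<close>) on a set that need not be open if it is so on some open
  neighbourhood of it. Functions being total, the extension to the neighbourhood is the function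
  itself, so that its derivatives at points of the set are those in the ambient space.
\<close>

definition C1_on ::
  "'a::real_normed_vector set \<Rightarrow> ('a \<Rightarrow> 'b::real_normed_vector) \<Rightarrow> bool" where
  "C1_on S f \<longleftrightarrow> (\<exists>\<Omega> f'. open \<Omega> \<and> S \<subseteq> \<Omega> \<and>
     (\<forall>x\<in>\<Omega>. (f has_derivative blinfun_apply (f' x)) (at x)) \<and> continuous_on \<Omega> f')"

definition C2_on ::
  "'a::real_normed_vector set \<Rightarrow> ('a \<Rightarrow> 'b::real_normed_vector) \<Rightarrow> bool" where
  "C2_on S f \<longleftrightarrow> (\<exists>\<Omega> f'. open \<Omega> \<and> S \<subseteq> \<Omega> \<and>
     (\<forall>x\<in>\<Omega>. (f has_derivative blinfun_apply (f' x)) (at x)) \<and> C1_on \<Omega> f')"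

definition gradient :: "('a::real_inner \<Rightarrow> real) \<Rightarrow> 'a \<Rightarrow> 'a" where
  "gradient g x = (THE D. GDERIV g x :> D)"

section \<open>Trajectories and Lyapunov exponents\<close>

definition trajectory :: "(real^'n \<Rightarrow> real^'n) \<Rightarrow> real^'n \<Rightarrow> (real \<Rightarrow> real^'n) \<Rightarrow> bool" where
  "trajectory f x0 x \<longleftrightarrow>
     x 0 = x0 \<and> (\<forall>t\<ge>0. (x has_vector_derivative f (x t)) (at t within {0..}))"

text \<open>Remaining in the set for all \<open>t \<ge> 0\<close> includes existence of the solution for all \<open>t \<ge> 0\<close>.\<close>

definition forward_invariant :: "(real^'n \<Rightarrow> real^'n) \<Rightarrow> (real^'n) set \<Rightarrow> bool" where
  "forward_invariant f S \<longleftrightarrow>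
     (\<forall>x0\<in>S. (\<exists>x. trajectory f x0 x) \<and> (\<forall>x. trajectory f x0 x \<longrightarrow> (\<forall>t\<ge>0. x t \<in> S)))"

definition compound_solution ::
  "nat \<Rightarrow> (real^'n::{finite,linorder} \<Rightarrow> real^'n::{finite,linorder}) \<Rightarrow> (real \<Rightarrow> real^'n::{finite,linorder}) \<Rightarrow>
   real^'m::{finite,linorder} \<Rightarrow> (real \<Rightarrow> real^'m::{finite,linorder}) \<Rightarrow> bool" where
  "compound_solution k f x y0 y \<longleftrightarrow>
     y 0 = y0 \<and> (\<forall>t\<ge>0. (y has_vector_derivative Df_compound k f (x t) *v y t) (at t within {0..}))"

text \<open>
  For \<open>f\<close> of class \<open>C\<^sup>1\<close> near the trajectory, \<open>x\<close> is determined on \<open>{0..}\<close> by \<open>x0\<close>, the linear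
  equation has a unique solution \<open>y\<close> on \<open>{0..}\<close> for each \<open>y0\<close>, and \<open>y t \<noteq> 0\<close> whenever
  \<open>y0 \<noteq> 0\<close>. The supremum below is therefore one over unit vectors \<open>y0\<close> only, and the
  conventional value \<open>ln 0 = 0\<close> plays no role. Values are extended reals, because the coefficients
  may be unbounded along a trajectory that is bounded but approaches the boundary of the domain.
\<close>

definition leading_exponent_sum ::
  "'m::{finite,linorder} itself \<Rightarrow> nat \<Rightarrow> (real^'n::{finite,linorder} \<Rightarrow> real^'n::{finite,linorder}) \<Rightarrow> real^'n::{finite,linorder} \<Rightarrow> ereal" where
  "leading_exponent_sum _ k f x0 =
     Sup {Limsup at_top (\<lambda>t. ereal (1 / t * ln (norm (y t)))) | x y0 y.
            trajectory f x0 x \<and>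
            y0 \<in> sphere (0 :: real^'m::{finite,linorder}) 1 \<and> compound_solution k f x y0 y}"

section \<open>Auxiliary functions\<close>

definition m_field ::
  "nat \<Rightarrow> (real^'n::{finite,linorder} \<Rightarrow> real^'n::{finite,linorder}) \<Rightarrow> real \<Rightarrow> real^'n::{finite,linorder} \<Rightarrow>
   real^'m::{finite,linorder} \<Rightarrow> real^'m::{finite,linorder}" where
  "m_field k f B x w = Df_compound k f x *v w - B *\<^sub>R w"

definition admissible ::
  "nat \<Rightarrow> (real^'n::{finite,linorder} \<Rightarrow> real^'n::{finite,linorder}) \<Rightarrow> (real^'n::{finite,linorder}) set \<Rightarrow> real \<Rightarrow>
   ((real^'n::{finite,linorder}) \<times> (real^'m::{finite,linorder}) \<Rightarrow> real) \<Rightarrow> bool" where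
  "admissible k f S B V \<longleftrightarrow> C1_on (S \<times> UNIV) V \<and>
     (\<forall>x\<in>S. \<forall>w. V (x, w) \<ge> (norm w)\<^sup>2 \<and>
        f x \<bullet> gradient (\<lambda>\<xi>. V (\<xi>, w)) x +
        m_field k f B x w \<bullet> gradient (\<lambda>\<omega>. V (x, \<omega>)) w \<le> 0)"

end

theory Submission
  imports Defs
begin

text \<open>
  Upper bound: with \<open>w t = exp (- B t) y t\<close>, the function \<open>V (x t, w t)\<close> is nonincreasing and
  dominates \<open>|w t|\<^sup>2\<close>, so that \<open>y\<close> grows at most like \<open>exp (B t)\<close>.

  Sharpness: for \<open>B\<close> above the supremum of the exponents, every solution of
  \<open>w' = Df\<^sup>[\<^sup>k\<^sup>](x) w - B w\<close> tends to \<open>0\<close>, and by compactness it is halved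
  after a time \<open>T\<close> independent of the starting point. If \<open>\<Phi>\<close> is the solution operator,
  \<open>U = \<integral>\<^sub>0\<^sup>T transpose \<Phi> ** \<Phi> dt\<close> would do, but it has to be \<open>C\<^sup>1\<close> on a neighbourhood of the
  compact set. The integral is therefore replaced by a sum over the iterates of the Euler map
  \<open>(x, w) \<mapsto> (x + h f(x), w + h (Df\<^sup>[\<^sup>k\<^sup>](x) w - B w))\<close>, whose smoothness needs no theory of flows;
  the error vanishes with \<open>h\<close> because the right-hand side is \<open>C\<^sup>1\<close>.
\<close>

section \<open>Continuously differentiable functions\<close>

text \<open>\<open>C1_on\<close> a set means differentiability on some open neighbourhood, but
  trajectories are only known to exist for all time when they start in the set. A matrix built from
  the flow would need a flow off \<open>S\<close> up to time \<open>T\<close>, and its derivative in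
  the initial value. A fixed number of Euler steps is a finite composition of \<open>C1_on\<close>
  maps, regular as long as its points stay in the neighbourhood. The price is that an iterate E no
  longer carries the field to itself: DE(z) F(z) = F(E z) fails by an amount governed by the modulus
  of continuity of DF. This is where \<open>C2_on\<close> for \<open>f\<close> enters, since the
  skew field contains \<open>Df_compound\<close> and has to be C1. The failure is absorbed by the
  margin that halving leaves on unit vectors, and homogeneity of degree two in w carries the
  inequality to all w. The sum has no factor \<open>h\<close>, so its first summand is |w|^2 itself
  and gives the lower bound on V.\<close>

lemma C1_onI:
  fixes f :: "'a::euclidean_space \<Rightarrow> 'b::real_normed_vector"
  assumes "open \<Omega>" "S \<subseteq> \<Omega>"
    and D: "\<And>x. x \<in> \<Omega> \<Longrightarrow> (f has_derivative D x) (at x)"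
    and cont: "\<And>h. continuous_on \<Omega> (\<lambda>x. D x h)"
  shows "C1_on S f"
  unfolding C1_on_def
proof (intro exI[of _ \<Omega>] exI[of _ "\<lambda>x. Blinfun (D x)"] conjI ballI assms)
  have *: "blinfun_apply (Blinfun (D x)) = D x" if "x \<in> \<Omega>" for x
    using D[OF that] by (intro bounded_linear_Blinfun_apply has_derivative_bounded_linear)
  then show "(f has_derivative blinfun_apply (Blinfun (D x))) (at x)" if "x \<in> \<Omega>" for x
    using D that by simp
  \<comment> \<open>The domain has finite dimension, so continuity of the derivative in each
    direction gives continuity in operator norm.\<close>
  show "continuous_on \<Omega> (\<lambda>x. Blinfun (D x))"
    using * cont by (intro continuous_on_blinfun_componentwise) (simp cong: continuous_on_cong)
qed

lemma C1_onE:
  assumes "C1_on S f"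
  obtains \<Omega> f' where "open \<Omega>" "S \<subseteq> \<Omega>"
    "\<And>x. x \<in> \<Omega> \<Longrightarrow> (f has_derivative blinfun_apply (f' x)) (at x)" "continuous_on \<Omega> f'"
  using assms unfolding C1_on_def by blast

lemma C1_on_subset: "C1_on T f \<Longrightarrow> S \<subseteq> T \<Longrightarrow> C1_on S f"
  unfolding C1_on_def by (meson order_trans)

lemma C1_on_continuous_on: "C1_on S f \<Longrightarrow> continuous_on S f"
proof -
  assume "C1_on S f"
  then obtain \<Omega> f' where f: "S \<subseteq> \<Omega>"
    "\<And>x. x \<in> \<Omega> \<Longrightarrow> (f has_derivative blinfun_apply (f' x)) (at x)"
    using C1_onE by metis
  show ?thesis
    by (rule has_derivative_continuous_on[OF has_derivative_at_withinI[OF f(2)]]) (use f(1) in auto)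
qed

lemma C1_on_bounded_linear:
  assumes "bounded_linear f"
  shows "C1_on S f"
  unfolding C1_on_def
  using assms bounded_linear_imp_has_derivative[OF assms]
  by (intro exI[of _ UNIV] exI[of _ "\<lambda>x. Blinfun f"]) (simp add: bounded_linear_Blinfun_apply)

lemma C1_on_compose:
  assumes "C1_on S f" "C1_on T g" "f ` S \<subseteq> T"
  shows "C1_on S (\<lambda>x. g (f x))"
proof -
  obtain \<Omega> f' where f: "open \<Omega>" "S \<subseteq> \<Omega>"
    "\<And>x. x \<in> \<Omega> \<Longrightarrow> (f has_derivative blinfun_apply (f' x)) (at x)" "continuous_on \<Omega> f'"
    using C1_onE[OF assms(1)] by blast
  obtain \<Theta> g' where g: "open \<Theta>" "T \<subseteq> \<Theta>"
    "\<And>x. x \<in> \<Theta> \<Longrightarrow> (g has_derivative blinfun_apply (g' x)) (at x)" "continuous_on \<Theta> g'"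
    using C1_onE[OF assms(2)] by blast
  let ?O = "\<Omega> \<inter> f -` \<Theta>"
  have cf: "continuous_on \<Omega> f"
    by (rule has_derivative_continuous_on[OF has_derivative_at_withinI[OF f(3)]]) simp
  have "open ?O"
    using cf f(1) g(1) by (rule continuous_open_preimage)
  moreover have "S \<subseteq> ?O" using f(2) g(2) assms(3) by blast
  moreover have "((\<lambda>x. g (f x)) has_derivative blinfun_apply (g' (f x) o\<^sub>L f' x)) (at x)"
    if "x \<in> ?O" for x
  proof -
    have "((\<lambda>x. g (f x)) has_derivative (\<lambda>h. g' (f x) (f' x h))) (at x)"
      by (rule has_derivative_compose[OF f(3) g(3)]) (use that in auto)
    then show ?thesis by (rule has_derivative_eq_rhs) (simp add: fun_eq_iff)
  qed
  moreover have "continuous_on ?O (\<lambda>x. g' (f x) o\<^sub>L f' x)"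
    by (intro continuous_intros continuous_on_compose2[OF g(4)] continuous_on_subset[OF cf]
        continuous_on_subset[OF f(4)]) auto
  ultimately show ?thesis
    unfolding C1_on_def
    by (intro exI[of _ ?O] exI[of _ "\<lambda>x. g' (f x) o\<^sub>L f' x"] conjI ballI) assumption+
qed

lemma C1_on_Pair:
  fixes f :: "'a::euclidean_space \<Rightarrow> 'b::real_normed_vector" and g :: "'a \<Rightarrow> 'c::real_normed_vector"
  assumes "C1_on S f" "C1_on S g"
  shows "C1_on S (\<lambda>x. (f x, g x))"
proof -
  obtain \<Omega> f' where f: "open \<Omega>" "S \<subseteq> \<Omega>"
    "\<And>x. x \<in> \<Omega> \<Longrightarrow> (f has_derivative blinfun_apply (f' x)) (at x)" "continuous_on \<Omega> f'"
    using C1_onE[OF assms(1)] by blast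
  obtain \<Theta> g' where g: "open \<Theta>" "S \<subseteq> \<Theta>"
    "\<And>x. x \<in> \<Theta> \<Longrightarrow> (g has_derivative blinfun_apply (g' x)) (at x)" "continuous_on \<Theta> g'"
    using C1_onE[OF assms(2)] by blast
  show ?thesis
  proof (rule C1_onI[of "\<Omega> \<inter> \<Theta>" _ _ "\<lambda>x h. (f' x h, g' x h)"])
    show "((\<lambda>x. (f x, g x)) has_derivative (\<lambda>h. (f' x h, g' x h))) (at x)"
      if "x \<in> \<Omega> \<inter> \<Theta>" for x
      using that f(3) g(3) by (intro has_derivative_Pair) auto
    show "continuous_on (\<Omega> \<inter> \<Theta>) (\<lambda>x. (f' x h, g' x h))" for h
      by (intro continuous_intros continuous_on_subset[OF f(4)] continuous_on_subset[OF g(4)]) auto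
  qed (use f g in auto)
qed

lemma C1_on_bilinear:
  fixes f :: "'a::euclidean_space \<Rightarrow> 'b::real_normed_vector" and g :: "'a \<Rightarrow> 'c::real_normed_vector"
    and prod :: "'b \<Rightarrow> 'c \<Rightarrow> 'd::real_normed_vector"
  assumes bil: "bounded_bilinear prod" and "C1_on S f" "C1_on S g"
  shows "C1_on S (\<lambda>x. prod (f x) (g x))"
proof -
  interpret bounded_bilinear prod by fact
  obtain \<Omega> f' where f: "open \<Omega>" "S \<subseteq> \<Omega>"
    "\<And>x. x \<in> \<Omega> \<Longrightarrow> (f has_derivative blinfun_apply (f' x)) (at x)" "continuous_on \<Omega> f'"
    using C1_onE[OF assms(2)] by blast
  obtain \<Theta> g' where g: "open \<Theta>" "S \<subseteq> \<Theta>"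
    "\<And>x. x \<in> \<Theta> \<Longrightarrow> (g has_derivative blinfun_apply (g' x)) (at x)" "continuous_on \<Theta> g'"
    using C1_onE[OF assms(3)] by blast
  have cf: "continuous_on (\<Omega> \<inter> \<Theta>) f"
    by (rule has_derivative_continuous_on[OF has_derivative_at_withinI[OF f(3)]]) simp
  have cg: "continuous_on (\<Omega> \<inter> \<Theta>) g"
    by (rule has_derivative_continuous_on[OF has_derivative_at_withinI[OF g(3)]]) simp
  show ?thesis
  proof (rule C1_onI[of "\<Omega> \<inter> \<Theta>" _ _ "\<lambda>x h. prod (f x) (g' x h) + prod (f' x h) (g x)"])
    show "((\<lambda>x. prod (f x) (g x)) has_derivative (\<lambda>h. prod (f x) (g' x h) + prod (f' x h) (g x))) (at x)"
      if "x \<in> \<Omega> \<inter> \<Theta>" for x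
      using that f(3) g(3) by (intro FDERIV) auto
    show "continuous_on (\<Omega> \<inter> \<Theta>) (\<lambda>x. prod (f x) (g' x h) + prod (f' x h) (g x))" for h
      by (intro continuous_intros continuous_on cf cg continuous_on_subset[OF f(4)]
          continuous_on_subset[OF g(4)]) auto
  qed (use f g in auto)
qed

lemma C1_on_add:
  fixes f g :: "'a::euclidean_space \<Rightarrow> 'b::real_normed_vector"
  assumes "C1_on S f" "C1_on S g"
  shows "C1_on S (\<lambda>x. f x + g x)"
  using C1_on_compose[OF C1_on_Pair[OF assms] C1_on_bounded_linear[of "\<lambda>p. fst p + snd p" UNIV]]
  by (simp add: bounded_linear_add bounded_linear_fst bounded_linear_snd)

lemma C1_on_const: "C1_on S (\<lambda>x. c)"
  unfolding C1_on_def by (intro exI[of _ UNIV] exI[of _ "\<lambda>x. 0"]) (simp add: has_derivative_const zero_blinfun.rep_eq)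

lemma C1_on_sum:
  fixes f :: "'i \<Rightarrow> 'a::euclidean_space \<Rightarrow> 'b::real_normed_vector"
  assumes "\<And>i. i \<in> I \<Longrightarrow> C1_on S (f i)"
  shows "C1_on S (\<lambda>x. \<Sum>i\<in>I. f i x)"
proof (cases "finite I")
  case True
  then show ?thesis using assms
    by (induction I) (auto intro: C1_on_const C1_on_add)
qed (simp add: C1_on_const)

lemma C1_on_componentwise:
  fixes f :: "'a::euclidean_space \<Rightarrow> 'b::euclidean_space"
  assumes "\<And>i. i \<in> Basis \<Longrightarrow> C1_on S (\<lambda>x. f x \<bullet> i)"
  shows "C1_on S f"
proof -
  have "C1_on S (\<lambda>x. \<Sum>i\<in>Basis. (f x \<bullet> i) *\<^sub>R i)"
    by (intro C1_on_sum C1_on_bilinear[OF bounded_bilinear_scaleR] C1_on_const assms)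
  then show ?thesis by (simp add: euclidean_representation)
qed

section \<open>Uniform estimates on compact sets\<close>

lemma compact_neighbourhood_within:
  fixes K :: "'a::euclidean_space set"
  assumes "compact K" "open \<Omega>" "K \<subseteq> \<Omega>"
  obtains r K' where "r > 0" "compact K'" "K' \<subseteq> \<Omega>" "\<And>x. x \<in> K \<Longrightarrow> cball x r \<subseteq> K'"
proof -
  obtain r where r: "r > 0" "(\<Union>x\<in>K. cball x r) \<subseteq> \<Omega>"
    using compact_subset_open_imp_cball_epsilon_subset[OF assms] by metis
  \<comment> \<open>Written as the sum of \<open>K\<close> and a closed ball, the neighbourhood is
    compact.\<close>
  have eq: "(\<Union>x\<in>K. cball x r) = (\<Union>x\<in>K. \<Union>y\<in>cball 0 r. {x + y})"
  proof (intro equalityI subsetI)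
    fix z assume "z \<in> (\<Union>x\<in>K. cball x r)"
    then obtain x where "x \<in> K" "dist x z \<le> r" by auto
    then show "z \<in> (\<Union>x\<in>K. \<Union>y\<in>cball 0 r. {x + y})"
      by (intro UN_I[of x] UN_I[of "z - x"]) (auto simp: dist_norm norm_minus_commute)
  next
    fix z assume "z \<in> (\<Union>x\<in>K. \<Union>y\<in>cball 0 r. {x + y})"
    then obtain x y where "x \<in> K" "norm y \<le> r" "z = x + y" by auto
    then show "z \<in> (\<Union>x\<in>K. cball x r)" by (intro UN_I[of x]) (auto simp: dist_norm)
  qed
  have "compact (\<Union>x\<in>K. cball x r)"
    unfolding eq using compact_sums'[OF assms(1) compact_cball[of 0 r]] by simp
  with r that show thesis by blast
qed

text \<open>\<open>K\<close> may fail to be convex, so the mean value inequality gives only local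
  constants; compactness makes one constant serve all pairs. The time parameter in the proof is a
  dummy.\<close>

lemma C1_on_compact_lipschitz:
  fixes f :: "'a::euclidean_space \<Rightarrow> 'a"
  assumes "C1_on K f" "compact K"
  obtains L where "L \<ge> 0" "\<And>x y. x \<in> K \<Longrightarrow> y \<in> K \<Longrightarrow> norm (f x - f y) \<le> L * norm (x - y)"
proof -
  obtain \<Omega> f' where f: "open \<Omega>" "K \<subseteq> \<Omega>"
    "\<And>x. x \<in> \<Omega> \<Longrightarrow> (f has_derivative blinfun_apply (f' x)) (at x)" "continuous_on \<Omega> f'"
    using C1_onE[OF assms(1)] by blast
  have "local_lipschitz (UNIV :: real set) \<Omega> (\<lambda>t. f)"
    by (rule c1_implies_local_lipschitz[where f' = "\<lambda>(t, x). f' x"])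
      (use f in \<open>auto intro!: continuous_on_compose2[OF f(4)] continuous_intros simp: case_prod_beta\<close>)
  then have "local_lipschitz (UNIV :: real set) K (\<lambda>t. f)"
    by (rule local_lipschitz_subset) (use f in auto)
  then have "local_lipschitz {0::real} K (\<lambda>t. f)"
    by (rule local_lipschitz_subset) auto
  then obtain L where "\<And>t. t \<in> {0::real} \<Longrightarrow> L-lipschitz_on K f"
    by (rule local_lipschitz_compact_implies_lipschitz[OF _ assms(2)]) auto
  then have L: "L-lipschitz_on K f" by simp
  show thesis
    by (rule that[of L]) (use L in \<open>auto simp: lipschitz_on_def dist_norm\<close>)
qed

text \<open>Uniform continuity of \<open>f'\<close> on a compact thickening of \<open>K\<close>
  makes its oscillation on small balls at most \<open>e\<close>. Balls are convex, so the mean value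
  inequality turns this into a first-order remainder that is uniform in \<open>x\<close>, even when
  \<open>x + v\<close> leaves \<open>K\<close>.\<close>

lemma C1_on_compact_uniform_derivative:
  fixes f :: "'a::euclidean_space \<Rightarrow> 'b::real_normed_vector"
  assumes "open \<Omega>" "compact K" "K \<subseteq> \<Omega>"
    and D: "\<And>x. x \<in> \<Omega> \<Longrightarrow> (f has_derivative blinfun_apply (f' x)) (at x)"
    and cont: "continuous_on \<Omega> f'" and "e > 0"
  obtains d where "d > 0"
    "\<And>x v. x \<in> K \<Longrightarrow> norm v \<le> d \<Longrightarrow> norm (f (x + v) - f x - f' x v) \<le> e * norm v"
proof -
  obtain r K' where r: "r > 0" "compact K'" "K' \<subseteq> \<Omega>" "\<And>x. x \<in> K \<Longrightarrow> cball x r \<subseteq> K'"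
    using compact_neighbourhood_within[OF assms(2,1,3)] by metis
  have "uniformly_continuous_on K' f'"
    using r cont by (intro compact_uniformly_continuous) (auto intro: continuous_on_subset)
  then obtain d where d: "d > 0" "\<And>x y. x \<in> K' \<Longrightarrow> y \<in> K' \<Longrightarrow> dist y x < d \<Longrightarrow> dist (f' y) (f' x) < e"
    unfolding uniformly_continuous_on_def using \<open>e > 0\<close> by metis
  show thesis
  proof (rule that[of "min (d/2) r"])
    show "min (d/2) r > 0" using d r by simp
    fix x v :: 'a assume x: "x \<in> K" and v: "norm v \<le> min (d/2) r"
    have sub: "cball x (min (d/2) r) \<subseteq> K'" using r(4)[OF x] by auto
    have "norm (f (x + v) - f x - f' x (x + v - x)) \<le> norm (x + v - x) * e"
    proof (rule differentiable_bound_linearization[where S = "cball x (min (d/2) r)" and f' = "\<lambda>x. blinfun_apply (f' x)" and ?x0.0 = x])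
      fix t :: real assume "t \<in> {0..1}"
      then have "\<bar>t\<bar> * norm v \<le> 1 * norm v" by (intro mult_right_mono) auto
      then show "x + t *\<^sub>R (x + v - x) \<in> cball x (min (d / 2) r)"
        using v by (simp add: dist_norm)
    next
      fix y assume y: "y \<in> cball x (min (d/2) r)"
      show "(f has_derivative blinfun_apply (f' y)) (at y within cball x (min (d / 2) r))"
        by (rule has_derivative_at_withinI[OF D]) (use sub r(3) y in blast)
      have xK: "x \<in> K'" using sub d r by (auto simp: subset_iff)
      have "dist y x < d" using y d(1) by (auto simp: dist_commute)
      then have "dist (f' y) (f' x) < e"
        by (rule d(2)[OF xK subsetD[OF sub y]])
      then have "norm (f' y - f' x) \<le> e" by (simp add: dist_norm)
      moreover have "blinfun_apply (f' y) - blinfun_apply (f' x) = blinfun_apply (f' y - f' x)"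
        by (simp add: fun_eq_iff blinfun.diff_left)
      ultimately show "onorm (blinfun_apply (f' y) - blinfun_apply (f' x)) \<le> e"
        by (simp add: norm_blinfun.rep_eq)
    qed (use d r in auto)
    then show "norm (f (x + v) - f x - f' x v) \<le> e * norm v" by (simp add: mult.commute)
  qed
qed

section \<open>Gronwall estimates\<close>

text \<open>The squared norm is differentiable even where \<open>g\<close> vanishes. Weighted with
  \<open>exp (- 2 * L * s)\<close> it cannot end above its initial value, weighted with
  \<open>exp (2 * L * s)\<close> it cannot end below it. The second bound keeps nonzero solutions of
  linear equations away from 0.\<close>

lemma gronwall_norm:
  fixes g :: "real \<Rightarrow> 'a::real_inner"
  assumes g: "\<And>t. t \<in> {0..T} \<Longrightarrow> (g has_vector_derivative g' t) (at t within {0..T})"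
    and bd: "\<And>t. t \<in> {0..T} \<Longrightarrow> norm (g' t) \<le> L * norm (g t)"
    and t: "t \<in> {0..T}"
  shows "norm (g t) \<le> exp (L * t) * norm (g 0)" and "norm (g 0) \<le> exp (L * t) * norm (g t)"
proof -
  have ip: "\<bar>g s \<bullet> g' s\<bar> \<le> L * (g s \<bullet> g s)" if "s \<in> {0..T}" for s
  proof -
    have "\<bar>g s \<bullet> g' s\<bar> \<le> norm (g s) * norm (g' s)" by (rule Cauchy_Schwarz_ineq2)
    also have "\<dots> \<le> norm (g s) * (L * norm (g s))" by (intro mult_left_mono bd that) simp
    finally show ?thesis by (simp add: dot_square_norm power2_eq_square ac_simps)
  qed
  define \<phi> where "\<phi> c s = (g s \<bullet> g s) * exp (c * s)" for c s
  have der: "(\<phi> c has_derivative (\<lambda>h. h * ((2 * (g s \<bullet> g' s) + c * (g s \<bullet> g s)) * exp (c * s))))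
      (at s within {0..t})" if "s \<in> {0..t}" for c s
  proof -
    have 1: "(g has_vector_derivative g' s) (at s within {0..t})"
      by (rule has_vector_derivative_within_subset[OF g]) (use t that in auto)
    have "((\<lambda>s. (g s \<bullet> g s) * exp (c * s)) has_derivative
      (\<lambda>h. h * ((2 * (g s \<bullet> g' s) + c * (g s \<bullet> g s)) * exp (c * s)))) (at s within {0..t})"
      using 1 unfolding has_vector_derivative_def
      by (auto intro!: derivative_eq_intros simp: algebra_simps inner_commute)
    then show ?thesis by (simp add: \<phi>_def[abs_def])
  qed
  have mvt: "\<exists>s\<in>{0..t}. \<phi> c t - \<phi> c 0 = t * ((2 * (g s \<bullet> g' s) + c * (g s \<bullet> g s)) * exp (c * s))" for c
    using mvt_very_simple[of 0 t "\<phi> c", OF _ der[of _ c]] t by auto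
  have sq: "\<phi> (- 2 * L) t * exp (L * t) * exp (L * t) = (norm (g t))\<^sup>2"
    "\<phi> (2 * L) t = (exp (L * t) * norm (g t))\<^sup>2" "\<phi> c 0 = (norm (g 0))\<^sup>2" for c
    by (auto simp: \<phi>_def dot_square_norm power_mult_distrib mult.assoc simp flip: exp_add exp_double)
  obtain s where s: "s \<in> {0..t}"
    "\<phi> (- 2*L) t - \<phi> (- 2*L) 0 = t * ((2 * (g s \<bullet> g' s) + (- 2*L) * (g s \<bullet> g s)) * exp (- 2*L * s))"
    using mvt by blast
  have "2 * (g s \<bullet> g' s) + (- 2*L) * (g s \<bullet> g s) \<le> 0" using ip[of s] s t by auto
  then have "\<phi> (- 2*L) t - \<phi> (- 2*L) 0 \<le> 0"
    unfolding s(2) using t by (intro mult_nonneg_nonpos mult_nonpos_nonneg) auto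
  then have "(norm (g t))\<^sup>2 \<le> (norm (g 0))\<^sup>2 * exp (L * t) * exp (L * t)"
    unfolding sq(1)[symmetric] sq(3)[symmetric, of "-2*L"] by (intro mult_right_mono) auto
  then have "(norm (g t))\<^sup>2 \<le> (exp (L * t) * norm (g 0))\<^sup>2"
    by (simp add: power2_eq_square ac_simps)
  then show "norm (g t) \<le> exp (L * t) * norm (g 0)" by (rule power2_le_imp_le) auto
  obtain s where s: "s \<in> {0..t}"
    "\<phi> (2*L) t - \<phi> (2*L) 0 = t * ((2 * (g s \<bullet> g' s) + (2*L) * (g s \<bullet> g s)) * exp (2*L * s))"
    using mvt by blast
  have "2 * (g s \<bullet> g' s) + (2*L) * (g s \<bullet> g s) \<ge> 0" using ip[of s] s t by auto
  then have "\<phi> (2*L) t - \<phi> (2*L) 0 \<ge> 0" unfolding s(2) using t by auto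
  then have "(norm (g 0))\<^sup>2 \<le> (exp (L * t) * norm (g t))\<^sup>2" by (simp add: sq)
  then show "norm (g 0) \<le> exp (L * t) * norm (g t)" by (rule power2_le_imp_le) auto
qed

text \<open>The factor \<open>real j * h\<close> replaces the sharper quotient (exp (L j h) - 1) /
  L, so that \<open>L = 0\<close> is no special case.\<close>

lemma discrete_gronwall:
  fixes a :: "nat \<Rightarrow> real"
  assumes "a 0 = 0" "L \<ge> 0" "h \<ge> 0" "c \<ge> 0"
    and "\<And>i. i < j \<Longrightarrow> a (Suc i) \<le> (1 + L * h) * a i + c * h"
  shows "a j \<le> c * (real j * h) * exp (L * (real j * h))"
  using assms(5)
proof (induction j)
  case 0 then show ?case using assms by simp
next
  case (Suc j)
  have IH: "a j \<le> c * (real j * h) * exp (L * (real j * h))" using Suc by auto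
  have e: "1 + L * h \<le> exp (L * h)" by (rule exp_ge_add_one_self)
  have "a (Suc j) \<le> (1 + L * h) * a j + c * h" using Suc by auto
  also have "\<dots> \<le> (1 + L * h) * (c * (real j * h) * exp (L * (real j * h))) + c * h"
    using IH assms by (intro add_right_mono mult_left_mono) auto
  also have "\<dots> \<le> exp (L * h) * (c * (real j * h) * exp (L * (real j * h))) + c * h * exp (L * (real (Suc j) * h))"
  proof (intro add_mono mult_right_mono e)
    show "c * h \<le> c * h * exp (L * (real (Suc j) * h))"
      using assms by (intro mult_le_cancel_left1[THEN iffD2] impI conjI)
        (auto simp: zero_le_mult_iff not_less[symmetric] mult_less_0_iff)
  qed (use assms in auto)
  also have "\<dots> = c * (real (Suc j) * h) * exp (L * (real (Suc j) * h))"
    by (simp add: algebra_simps exp_add)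
  finally show ?case .
qed

section \<open>The Euler method\<close>

definition solution :: "('a::real_normed_vector \<Rightarrow> 'a) \<Rightarrow> (real \<Rightarrow> 'a) \<Rightarrow> bool" where
  "solution F z \<longleftrightarrow> (\<forall>t\<ge>0. (z has_vector_derivative F (z t)) (at t within {0..}))"

lemma solutionD:
  assumes "solution F z" "t \<in> T" "T \<subseteq> {0..}"
  shows "(z has_vector_derivative F (z t)) (at t within T)"
  using assms unfolding solution_def by (auto intro: has_vector_derivative_within_subset)

lemma solution_continuous_on:
  assumes "solution F z"
  shows "continuous_on {0..} z"
  using solutionD[OF assms, of _ "{0..}"] unfolding continuous_on_eq_continuous_within
  by (auto intro: has_vector_derivative_continuous)

lemma solution_shift:
  assumes "solution F z" "s \<ge> 0"
  shows "solution F (\<lambda>t. z (s + t))"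
  unfolding solution_def
proof (intro allI impI)
  fix t :: real assume t: "t \<ge> 0"
  have "(z has_vector_derivative F (z (s + t))) (at (s + t) within (\<lambda>t. s + t) ` {0..})"
    by (rule solutionD[OF assms(1)]) (use assms(2) t in auto)
  then have "((z \<circ> (\<lambda>t. s + t)) has_vector_derivative 1 *\<^sub>R F (z (s + t))) (at t within {0..})"
    by (intro vector_diff_chain_within) (auto intro!: derivative_eq_intros)
  then show "((\<lambda>t. z (s + t)) has_vector_derivative F (z (s + t))) (at t within {0..})"
    by (simp add: o_def)
qed

definition euler_step :: "('a::real_vector \<Rightarrow> 'a) \<Rightarrow> real \<Rightarrow> 'a \<Rightarrow> 'a" where
  "euler_step F h z = z + h *\<^sub>R F z"

lemma euler_Suc:
  "euler_step F h ^^ Suc j = (\<lambda>z. (euler_step F h ^^ j) z + h *\<^sub>R F ((euler_step F h ^^ j) z))"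
  by (simp add: fun_eq_iff euler_step_def)

text \<open>The field is evaluated only at the iterates before the \<open>j\<close>-th, so only
  these have to lie in \<open>\<Omega>\<close>.\<close>

lemma C1_on_euler:
  fixes F :: "'a::euclidean_space \<Rightarrow> 'a"
  assumes F: "C1_on \<Omega> F"
    and "\<And>z i. z \<in> S \<Longrightarrow> i < j \<Longrightarrow> (euler_step F h ^^ i) z \<in> \<Omega>"
  shows "C1_on S (euler_step F h ^^ j)"
  using assms(2)
proof (induction j)
  case 0
  then show ?case by (simp add: C1_on_bounded_linear id_def bounded_linear_ident)
next
  case (Suc j)
  have "C1_on S (euler_step F h ^^ j)" using Suc by simp
  moreover have "C1_on \<Omega> (\<lambda>z. z + h *\<^sub>R F z)"
    by (intro C1_on_add C1_on_bounded_linear[OF bounded_linear_ident]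
        C1_on_bilinear[OF bounded_bilinear_scaleR] C1_on_const F)
  ultimately have "C1_on S (\<lambda>z. (euler_step F h ^^ j) z + h *\<^sub>R F ((euler_step F h ^^ j) z))"
    by (rule C1_on_compose) (use Suc.prems in auto)
  then show ?case unfolding euler_Suc .
qed

text \<open>
  The Euler iterates serve as a substitute for the flow that is \<open>C\<^sup>1\<close> in the initial
  value for trivial reasons. The flow property \<open>D\<phi>\<^sub>t(z) F(z) = F(\<phi>\<^sub>t(z))\<close> survives approximately.
\<close>

lemma euler_approximation:
  fixes F :: "'a::euclidean_space \<Rightarrow> 'a"
  assumes F: "C1_on K F" and K: "compact K" and "e > 0" "T \<ge> 0"
  obtains h0 where "h0 > 0"
    "\<And>h z j. 0 < h \<Longrightarrow> h \<le> h0 \<Longrightarrow> solution F z \<Longrightarrow> (\<And>t. t \<in> {0..T} \<Longrightarrow> z t \<in> K) \<Longrightarrow> real j * h \<le> T \<Longrightarrow>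
       norm ((euler_step F h ^^ j) (z 0) - z (real j * h)) \<le> e \<and>
       (\<exists>D. ((euler_step F h ^^ j) has_derivative D) (at (z 0)) \<and>
          norm (D (F (z 0)) - F ((euler_step F h ^^ j) (z 0))) \<le> e)"
proof -
  obtain \<Omega> F' where \<Omega>: "open \<Omega>" "K \<subseteq> \<Omega>"
    and F': "\<And>x. x \<in> \<Omega> \<Longrightarrow> (F has_derivative blinfun_apply (F' x)) (at x)"
    and cont: "continuous_on \<Omega> F'"
    using C1_onE[OF F] by metis
  \<comment> \<open>Euler points drift off the solution and hence off \<open>K\<close>. All
    constants are taken on a compact thickening, and an error of at most \<open>r\<close> keeps the
    points in it.\<close>
  obtain r K' where r: "r > 0" and K': "compact K'" "K' \<subseteq> \<Omega>" and ball: "\<And>x. x \<in> K \<Longrightarrow> cball x r \<subseteq> K'"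
    using compact_neighbourhood_within[OF K \<Omega>] by metis
  have KK': "x \<in> K'" if "x \<in> K" for x using ball[OF that] r by auto
  have C1: "C1_on \<Omega> F"
    unfolding C1_on_def
    by (rule exI[of _ \<Omega>], rule exI[of _ F']) (simp add: \<Omega>(1) cont F')
  obtain L where L: "L \<ge> 0" "\<And>x y. x \<in> K' \<Longrightarrow> y \<in> K' \<Longrightarrow> norm (F x - F y) \<le> L * norm (x - y)"
    using C1_on_compact_lipschitz[OF C1_on_subset[OF C1 K'(2)] K'(1)] by metis
  have "compact (F ` K')"
    using K' C1_on_continuous_on[OF C1] by (intro compact_continuous_image) (auto intro: continuous_on_subset)
  then obtain M where M: "M > 0" "\<And>x. x \<in> K' \<Longrightarrow> norm (F x) \<le> M"
    using compact_imp_bounded bounded_pos by (metis imageI)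
  have "compact (F' ` K')"
    using K' cont by (intro compact_continuous_image) (auto intro: continuous_on_subset)
  then obtain N where N: "N > 0" "\<And>x. x \<in> K' \<Longrightarrow> norm (F' x) \<le> N"
    using compact_imp_bounded bounded_pos by (metis imageI)
  \<comment> \<open>Chosen so that the final Gronwall bound \<open>e1 * M * T * exp (N * T)\<close>
    stays below \<open>e\<close>; the summand 1 keeps the denominator positive when
    \<open>T = 0\<close>.\<close>
  define e1 where "e1 = e / (M * T * exp (N * T) + 1)"
  have pos1: "M * T * exp (N * T) + 1 > 0" using M \<open>T \<ge> 0\<close> by (intro add_nonneg_pos) auto
  then have e1: "e1 > 0" using \<open>e > 0\<close> by (simp add: e1_def)
  obtain d where d: "d > 0"
    "\<And>x v. x \<in> K' \<Longrightarrow> norm v \<le> d \<Longrightarrow> norm (F (x + v) - F x - F' x v) \<le> e1 * norm v"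
    using C1_on_compact_uniform_derivative[OF \<Omega>(1) K' F' cont e1] by metis
  \<comment> \<open>\<open>h * q\<close> will bound the global Euler error. In \<open>h0\<close>,
    the first entry keeps a step \<open>h *\<^sub>R F\<close> within the radius \<open>d\<close> of
    the remainder estimate, the second makes the global error at most \<open>r\<close> and
    \<open>e\<close>.\<close>
  define q where "q = L * M * T * exp (L * T) + 1"
  have q: "q > 0" unfolding q_def using L M \<open>T \<ge> 0\<close> by (intro add_nonneg_pos) auto
  define h0 where "h0 = min (d / M) (min r e / q)"
  show thesis
  proof (rule that[of h0])
    show "h0 > 0" using d M r q \<open>e > 0\<close> by (simp add: h0_def)
    fix h z j
    assume h: "0 < h" "h \<le> h0" and sol: "solution F z"
      and inK: "\<And>t. t \<in> {0..T} \<Longrightarrow> z t \<in> K" and jT: "real j * h \<le> T"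
    have hd: "h * M \<le> d" using h(2) M by (simp add: h0_def field_simps)
    have hq: "h * q \<le> min r e" using h(2) q by (simp add: h0_def field_simps)
    let ?E = "\<lambda>i. (euler_step F h ^^ i) (z 0)"
    have time: "real i * h \<in> {0..T}" if "i \<le> j" for i
    proof -
      have "real i * h \<le> real j * h" using that h by (intro mult_right_mono) auto
      then have "real i * h \<le> T" using jT by linarith
      then show ?thesis using h by simp
    qed
    have lip: "norm (z s - z t) \<le> norm (s - t) * M" if "s \<in> {0..T}" "t \<in> {0..T}" for s t
    proof -
      have "norm (z s - z t) \<le> M * norm (s - t)"
      proof (rule differentiable_bound[where S = "{0..T}" and f' = "\<lambda>u h. h *\<^sub>R F (z u)"])
        fix u assume u: "u \<in> {0..T}"
        show "(z has_derivative (\<lambda>h. h *\<^sub>R F (z u))) (at u within {0..T})"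
          using solutionD[OF sol u] by (simp add: has_vector_derivative_def)
        show "onorm (\<lambda>h. h *\<^sub>R F (z u)) \<le> M"
          using M(2)[OF KK'[OF inK[OF u]]] M(1)
          by (intro onorm_bound) (auto simp: mult.commute[of M] intro: mult_left_mono)
      qed (use that in auto)
      then show ?thesis by (simp add: mult.commute)
    qed
    \<comment> \<open>Local truncation error: along the solution the field changes by at most
      \<open>L * M * h\<close> during one step. The form constant times \<open>h\<close> fits the
      discrete Gronwall inequality.\<close>
    have loc: "norm (z (t + h) - z t - h *\<^sub>R F (z t)) \<le> (L * M * h) * h" if "t \<in> {0..T}" "t + h \<in> {0..T}" for t
    proof -
      have "norm (z (t + h) - z t - (t + h - t) *\<^sub>R F (z t)) \<le> norm (t + h - t) * (L * M * h)"
      proof (rule vector_differentiable_bound_linearization[where S = "{t..t+h}" and f' = "\<lambda>s. F (z s)" and ?x0.0 = t])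
        fix s assume s: "s \<in> {t..t+h}"
        then have s': "s \<in> {0..T}" using that by auto
        show "(z has_vector_derivative F (z s)) (at s within {t..t+h})"
          by (rule solutionD[OF sol s]) (use that in auto)
        have "norm (F (z s) - F (z t)) \<le> L * norm (z s - z t)"
          by (intro L(2) KK' inK s' that)
        also have "\<dots> \<le> L * (norm (s - t) * M)" by (intro mult_left_mono lip s' that L(1))
        also have "\<dots> \<le> L * (h * M)" using s M L by (intro mult_left_mono mult_right_mono) auto
        finally show "norm (F (z s) - F (z t)) \<le> L * M * h" by (simp add: ac_simps)
      qed (use h in \<open>auto simp: closed_segment_eq_real_ivl\<close>)
      then show ?thesis using h by (simp add: ac_simps)
    qed
    have close: "norm (?E i - z (real i * h)) \<le> min r e" if "i \<le> j" for i
      using that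
    \<comment> \<open>Strong induction, because the recursion up to \<open>i\<close> uses the
      Lipschitz constant on \<open>K'\<close> at every earlier iterate, and membership in
      \<open>K'\<close> is what the claim provides there.\<close>
    proof (induction i rule: less_induct)
      case (less i)
      have "norm (?E i - z (real i * h)) \<le> (L * M * h) * (real i * h) * exp (L * (real i * h))"
      proof (rule discrete_gronwall[where a = "\<lambda>i. norm (?E i - z (real i * h))"])
        fix l assume l: "l < i"
        let ?t = "real l * h"
        have t: "?t \<in> {0..T}" "?t + h \<in> {0..T}"
          using time[of l] time[of "Suc l"] l less.prems by (auto simp: algebra_simps)
        have "?E l \<in> cball (z ?t) r"
          using less.IH[OF l] l less.prems by (simp add: dist_norm norm_minus_commute)
        then have El: "?E l \<in> K'" using ball[OF inK[OF t(1)]] by auto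
        have "?E (Suc l) - z (?t + h) = (?E l - z ?t) + h *\<^sub>R (F (?E l) - F (z ?t)) - (z (?t + h) - z ?t - h *\<^sub>R F (z ?t))"
          by (simp add: euler_step_def algebra_simps)
        also have "norm \<dots> \<le> norm (?E l - z ?t) + norm (h *\<^sub>R (F (?E l) - F (z ?t))) + norm (z (?t + h) - z ?t - h *\<^sub>R F (z ?t))"
          by (meson norm_triangle_ineq4 norm_triangle_ineq order_trans add_right_mono)
        also have "\<dots> \<le> norm (?E l - z ?t) + h * (L * norm (?E l - z ?t)) + (L * M * h) * h"
          using L(2)[OF El KK'[OF inK[OF t(1)]]] h loc[OF t] by (intro add_mono) (auto intro: mult_left_mono)
        finally show "norm (?E (Suc l) - z (real (Suc l) * h)) \<le> (1 + L * h) * norm (?E l - z ?t) + (L * M * h) * h"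
          by (simp add: algebra_simps)
      qed (use L M h in auto)
      also have "\<dots> \<le> (L * M * h) * T * exp (L * T)"
        using time[OF less.prems] L M h \<open>T \<ge> 0\<close> by (intro mult_mono exp_le_cancel_iff[THEN iffD2] mult_left_mono mult_nonneg_nonneg) auto
      also have "\<dots> \<le> h * q" using h by (simp add: q_def algebra_simps)
      finally show ?case using hq by linarith
    qed
    have EK': "?E i \<in> K'" if "i \<le> j" for i
      using close[OF that] ball[OF inK[OF time[OF that]]] by (auto simp: dist_norm norm_minus_commute)
    \<comment> \<open>The chain rule along the orbit, which is also the Euler scheme of the
      variational equation.\<close>
    define D where "D = rec_nat (\<lambda>v. v) (\<lambda>i d v. d v + h *\<^sub>R F' (?E i) (d v))"
    have D0: "D 0 = (\<lambda>v. v)" and DS: "D (Suc i) = (\<lambda>v. D i v + h *\<^sub>R F' (?E i) (D i v))" for i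
      by (simp_all add: D_def)
    have der: "((euler_step F h ^^ i) has_derivative D i) (at (z 0))" if "i \<le> j" for i
      using that
    proof (induction i)
      case 0
      then show ?case by (simp add: D0 id_def)
    next
      case (Suc i)
      have IH: "((euler_step F h ^^ i) has_derivative D i) (at (z 0))" using Suc by simp
      have "(F has_derivative blinfun_apply (F' (?E i))) (at (?E i))"
        by (rule F') (use EK'[of i] Suc.prems K'(2) in auto)
      then have "((\<lambda>x. F ((euler_step F h ^^ i) x)) has_derivative (\<lambda>v. F' (?E i) (D i v))) (at (z 0))"
        by (rule has_derivative_compose[OF IH])
      then have "((\<lambda>x. (euler_step F h ^^ i) x + h *\<^sub>R F ((euler_step F h ^^ i) x)) has_derivative D (Suc i)) (at (z 0))"
        unfolding DS by (intro has_derivative_add has_derivative_scaleR_right IH)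
      then show ?case unfolding euler_Suc .
    qed
    \<comment> \<open>Both sequences start at \<open>F (z 0)\<close>. The first advances by the
      factor 1 + h DF exactly, the second up to the first-order remainder of \<open>F\<close>, at
      most \<open>e1 * M * h\<close> per step; Gronwall sums these defects with rate
      \<open>N\<close>.\<close>
    have "norm (D j (F (z 0)) - F (?E j)) \<le> (e1 * M) * (real j * h) * exp (N * (real j * h))"
    proof (rule discrete_gronwall[where a = "\<lambda>i. norm (D i (F (z 0)) - F (?E i))"])
      fix i assume i: "i < j"
      let ?w = "F (?E i)" and ?u = "D i (F (z 0))"
      have K: "?E i \<in> K'" using EK' i by simp
      have hw: "norm (h *\<^sub>R ?w) \<le> h * M" using M(2)[OF K] h by (auto intro: mult_left_mono)
      have alg: "u + a - z = (u - w) + (a - b) - (z - w - b)" for u a z w b :: 'a by simp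
      have "norm (F' (?E i) (?u - ?w)) \<le> N * norm (?u - ?w)"
        by (rule order_trans[OF norm_blinfun mult_right_mono[OF N(2)[OF K]]]) simp
      then have b1: "norm (h *\<^sub>R F' (?E i) (?u - ?w)) \<le> h * (N * norm (?u - ?w))"
        using h by (simp add: mult_left_mono)
      have "norm (F (?E i + h *\<^sub>R ?w) - ?w - F' (?E i) (h *\<^sub>R ?w)) \<le> e1 * norm (h *\<^sub>R ?w)"
        by (rule d(2)[OF K order_trans[OF hw hd]])
      also have "\<dots> \<le> e1 * (h * M)" using e1 hw by (intro mult_left_mono) auto
      finally have b2: "norm (F (?E i + h *\<^sub>R ?w) - ?w - F' (?E i) (h *\<^sub>R ?w)) \<le> e1 * (h * M)" .
      have "norm (D (Suc i) (F (z 0)) - F (?E (Suc i)))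
          = norm ((?u - ?w) + h *\<^sub>R F' (?E i) (?u - ?w) - (F (?E i + h *\<^sub>R ?w) - ?w - F' (?E i) (h *\<^sub>R ?w)))"
        by (intro arg_cong[where f = norm])
          (simp only: DS euler_Suc blinfun.diff_right blinfun.scaleR_right scaleR_diff_right alg)
      also have "\<dots> \<le> norm (?u - ?w) + norm (h *\<^sub>R F' (?E i) (?u - ?w)) + norm (F (?E i + h *\<^sub>R ?w) - ?w - F' (?E i) (h *\<^sub>R ?w))"
        by (rule order_trans[OF norm_triangle_ineq4 add_right_mono[OF norm_triangle_ineq]])
      also have "\<dots> \<le> norm (?u - ?w) + h * (N * norm (?u - ?w)) + e1 * (h * M)"
        using b1 b2 by linarith
      also have "\<dots> = (1 + N * h) * norm (?u - ?w) + e1 * M * h"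
        by (simp add: distrib_right mult.assoc mult.left_commute)
      finally show "norm (D (Suc i) (F (z 0)) - F (?E (Suc i))) \<le> (1 + N * h) * norm (?u - ?w) + e1 * M * h" .
    qed (use N M e1 h in \<open>auto simp: D0\<close>)
    also have "\<dots> \<le> (e1 * M) * T * exp (N * T)"
      using jT h N M e1 \<open>T \<ge> 0\<close> by (intro mult_mono exp_le_cancel_iff[THEN iffD2] mult_left_mono mult_nonneg_nonneg) auto
    also have "\<dots> \<le> e1 * (M * T * exp (N * T) + 1)" using e1 by (simp add: algebra_simps)
    also have "\<dots> = e" using pos1 by (simp add: e1_def)
    finally show "norm (?E j - z (real j * h)) \<le> e \<and>
       (\<exists>D. ((euler_step F h ^^ j) has_derivative D) (at (z 0)) \<and> norm (D (F (z 0)) - F (?E j)) \<le> e)"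
      using close[of j] der[of j] by (intro conjI exI[of _ "D j"]) auto
  qed
qed

section \<open>Linear differential equations\<close>

lemma integral_has_vector_derivative_Ici:
  fixes g :: "real \<Rightarrow> 'a::euclidean_space"
  assumes "continuous_on {0..} g" "t \<ge> 0"
  shows "((\<lambda>u. integral {0..u} g) has_vector_derivative g t) (at t within {0..})"
proof -
  have "((\<lambda>u. integral {0..u} g) has_vector_derivative g t) (at t within {0..t+1})"
    by (rule integral_has_vector_derivative) (use assms in \<open>auto intro: continuous_on_subset\<close>)
  moreover have "at t within {0..t+1} = at t within {0..}"
    by (rule at_within_nhd[where S = "{..<t+1}"]) (use assms in auto)
  ultimately show ?thesis by simp
qed

text \<open>
  The Picard operator is a contraction in the norm \<open>sup\<^sub>t exp (- c t) |y t|\<close>, so that the solution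
  exists for all times at once. The fixed point is \<open>z t = exp (- c t) y t\<close>.
\<close>

lemma linear_ode_solution_exists:
  fixes A :: "real \<Rightarrow> 'a::euclidean_space \<Rightarrow>\<^sub>L 'a"
  assumes A: "continuous_on {0..} A" and M: "\<And>t. t \<ge> 0 \<Longrightarrow> norm (A t) \<le> M"
  obtains y where "y 0 = y0" "\<And>t. t \<ge> 0 \<Longrightarrow> (y has_vector_derivative A t (y t)) (at t within {0..})"
proof -
  define N where "N = max M 1"
  have N: "N > 0" "\<And>t. t \<ge> 0 \<Longrightarrow> norm (A t) \<le> N"
    using M by (auto simp: N_def intro: max.coboundedI1)
  \<comment> \<open>The contraction factor of the weighted Picard operator is \<open>N / c\<close>,
    here 1/2; \<open>N\<close> is at least 1, so \<open>c\<close> is positive even for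
    \<open>M = 0\<close>.\<close>
  define c where "c = 2 * N"
  have c: "c > 0" using N by (simp add: c_def)
  define g where "g z s = exp (c * s) *\<^sub>R A s (z s)" for z :: "real \<Rightarrow> 'a" and s
  define I where "I z t = integral {0..t} (g z)" for z t
  have cg: "continuous_on {0..} (g z)" if "continuous_on UNIV z" for z
    unfolding g_def by (intro continuous_intros A continuous_on_subset[OF that]) auto
  have gint: "g z integrable_on {0..t}" if "continuous_on UNIV z" for z t
    by (rule integrable_continuous_real, rule continuous_on_subset[OF cg[OF that]]) auto
  have dI: "(I z has_vector_derivative g z t) (at t within {0..})" if "continuous_on UNIV z" "t \<ge> 0" for z t
    unfolding I_def[abs_def] by (rule integral_has_vector_derivative_Ici[OF cg[OF that(1)] that(2)])
  have est: "norm (exp (- c * t) *\<^sub>R (I z t - I w t)) \<le> 1/2 * d"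
    if z: "continuous_on UNIV z" and w: "continuous_on UNIV w" and "t \<ge> 0"
      and d: "\<And>s. norm (z s - w s) \<le> d" for z w t d
  proof -
    have d0: "d \<ge> 0" using norm_ge_zero d order_trans by blast
    have hi: "((\<lambda>s. exp (c * s) * (N * d)) has_integral (exp (c * t) / c * (N * d) - exp (c * 0) / c * (N * d))) {0..t}"
      using \<open>t \<ge> 0\<close> c
      by (intro fundamental_theorem_of_calculus)
        (auto simp: has_real_derivative_iff_has_vector_derivative[symmetric] intro!: derivative_eq_intros)
    have "I z t - I w t = integral {0..t} (\<lambda>s. g z s - g w s)"
      unfolding I_def by (rule integral_diff[symmetric]) (intro gint z w)+
    also have "norm \<dots> \<le> integral {0..t} (\<lambda>s. exp (c * s) * (N * d))"
    proof (rule integral_norm_bound_integral)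
      show "(\<lambda>s. g z s - g w s) integrable_on {0..t}" by (intro integrable_diff gint z w)
      show "(\<lambda>s. exp (c * s) * (N * d)) integrable_on {0..t}" using hi by blast
      fix s assume s: "s \<in> {0..t}"
      have "norm (A s (z s - w s)) \<le> N * d"
        by (rule order_trans[OF norm_blinfun]) (use s N d in \<open>auto intro!: mult_mono\<close>)
      then show "norm (g z s - g w s) \<le> exp (c * s) * (N * d)"
        by (simp add: g_def blinfun.diff_right flip: scaleR_diff_right)
    qed
    also have "\<dots> = exp (c * t) / c * (N * d) - exp (c * 0) / c * (N * d)"
      using hi by (rule integral_unique)
    also have "\<dots> \<le> exp (c * t) * (1/2 * d)"
      using N d0 by (simp add: c_def)
    finally have "exp (- c * t) * norm (I z t - I w t) \<le> exp (- c * t) * (exp (c * t) * (1/2 * d))"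
      by (rule mult_left_mono) simp
    also have "\<dots> = 1/2 * d" by (simp flip: mult.assoc exp_add)
    finally show ?thesis by simp
  qed
  \<comment> \<open>Bounded continuous functions live on the whole line; \<open>max 0 t\<close>
    freezes the values at negative times.\<close>
  define P where "P z t = exp (- c * max 0 t) *\<^sub>R (y0 + I z (max 0 t))" for z t
  have Pb: "P z \<in> bcontfun" if z: "continuous_on UNIV z" and b: "\<And>s. norm (z s) \<le> b" for z b
  proof (rule bcontfun_normI)
    have "continuous_on {0..} (I z)"
      unfolding continuous_on_eq_continuous_within
      using dI[OF z] by (auto intro: has_vector_derivative_continuous)
    then have "continuous_on UNIV (\<lambda>t. I z (max 0 t))"
      by (rule continuous_on_compose2) (auto intro!: continuous_intros)
    then show "continuous_on UNIV (P z)"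
      unfolding P_def by (intro continuous_intros)
    fix t :: real
    \<comment> \<open>The integral operator annihilates the zero function, so the contraction
      estimate against it also yields boundedness of \<open>P z\<close>.\<close>
    have zz: "I (\<lambda>_. 0) s = 0" for s by (simp add: I_def g_def[abs_def])
    have "norm (P z t) \<le> norm (exp (- c * max 0 t) *\<^sub>R y0) + norm (exp (- c * max 0 t) *\<^sub>R I z (max 0 t))"
      unfolding P_def scaleR_add_right by (rule norm_triangle_ineq)
    also have "norm (exp (- c * max 0 t) *\<^sub>R y0) \<le> norm y0"
      using c by (simp add: mult_left_le_one_le)
    also have "norm (exp (- c * max 0 t) *\<^sub>R I z (max 0 t)) \<le> 1/2 * b"
      using est[OF z, of "\<lambda>_. 0" "max 0 t" b] b by (simp add: zz)
    finally show "norm (P z t) \<le> norm y0 + 1/2 * b" by simp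
  qed
  define Q where "Q z = Bcontfun (P (apply_bcontfun z))" for z
  have Q: "apply_bcontfun (Q z) = P (apply_bcontfun z)" for z
    unfolding Q_def by (rule Bcontfun_inverse, rule Pb[of _ "norm z"]) (auto simp: norm_bounded)
  have "\<exists>!z. Q z = z"
  proof (rule banach_fix_type)
    show "\<forall>z w. dist (Q z) (Q w) \<le> 1/2 * dist z w"
    proof (intro allI dist_bound)
      fix z w :: "real \<Rightarrow>\<^sub>C 'a" and t :: real
      have "norm (exp (- c * max 0 t) *\<^sub>R (I (apply_bcontfun z) (max 0 t) - I (apply_bcontfun w) (max 0 t))) \<le> 1/2 * dist z w"
        by (rule est) (auto simp: dist_bounded simp flip: dist_norm)
      then show "dist (Q z t) (Q w t) \<le> 1/2 * dist z w"
        by (simp add: Q P_def dist_norm algebra_simps)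
    qed
  qed auto
  then obtain z where z: "Q z = z" by blast
  define y where "y t = y0 + I z t" for t
  show thesis
  proof (rule that[of y])
    show "y 0 = y0" by (simp add: y_def I_def)
    fix t :: real assume t: "t \<ge> 0"
    have "z t = exp (- c * t) *\<^sub>R y t"
      using arg_cong[OF z, of "\<lambda>z. apply_bcontfun z t"] t by (simp add: Q P_def y_def)
    then have "g z t = A t (y t)"
      by (simp add: g_def blinfun.scaleR_right flip: exp_add)
    moreover have "(y has_vector_derivative g z t) (at t within {0..})"
      using dI[OF _ t, of z] unfolding y_def[abs_def] by (auto intro!: derivative_eq_intros)
    ultimately show "(y has_vector_derivative A t (y t)) (at t within {0..})" by simp
  qed
qed

section \<open>Linear cocycles over a compact invariant set\<close>

text \<open>Adjoining the base point makes the linear equation along a trajectory autonomous, so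
  that the Euler estimates apply to base and fibre at once.\<close>

definition skew_field :: "('a \<Rightarrow> 'a) \<Rightarrow> ('a \<Rightarrow> 'b \<Rightarrow>\<^sub>L 'b) \<Rightarrow> 'a \<times> 'b \<Rightarrow> 'a \<times> 'b::real_normed_vector" where
  "skew_field f A p = (f (fst p), A (fst p) (snd p))"

lemma C1_on_skew_field:
  fixes f :: "'a::euclidean_space \<Rightarrow> 'a" and A :: "'a \<Rightarrow> 'b::euclidean_space \<Rightarrow>\<^sub>L 'b"
  assumes "C1_on S f" "C1_on S A"
  shows "C1_on (S \<times> UNIV) (skew_field f A)"
proof -
  have fst: "C1_on (S \<times> (UNIV :: 'b set)) fst" and snd: "C1_on (S \<times> (UNIV :: 'b set)) snd"
    by (intro C1_on_bounded_linear bounded_linear_fst bounded_linear_snd)+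
  have "C1_on (S \<times> (UNIV :: 'b set)) (\<lambda>p. f (fst p))"
    by (rule C1_on_compose[OF fst assms(1)]) auto
  moreover have "C1_on (S \<times> (UNIV :: 'b set)) (\<lambda>p. A (fst p))"
    by (rule C1_on_compose[OF fst assms(2)]) auto
  ultimately have "C1_on (S \<times> UNIV) (\<lambda>p. (f (fst p), A (fst p) (snd p)))"
    by (intro C1_on_Pair C1_on_bilinear[OF bounded_bilinear_blinfun_apply] snd)
  then show ?thesis by (simp add: skew_field_def[abs_def])
qed

lemma solution_skew_field_iff:
  "solution (skew_field f A) z \<longleftrightarrow> solution f (\<lambda>t. fst (z t)) \<and>
     (\<forall>t\<ge>0. ((\<lambda>t. snd (z t)) has_vector_derivative A (fst (z t)) (snd (z t))) (at t within {0..}))"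
  (is "?L \<longleftrightarrow> ?R")
proof
  assume L: ?L
  have "((\<lambda>t. fst (z t)) has_vector_derivative fst (skew_field f A (z t))) (at t within {0..})"
    "((\<lambda>t. snd (z t)) has_vector_derivative snd (skew_field f A (z t))) (at t within {0..})" if "t \<ge> 0" for t
    using L that unfolding solution_def
    by (auto intro: bounded_linear.has_vector_derivative[OF bounded_linear_fst]
        bounded_linear.has_vector_derivative[OF bounded_linear_snd])
  then show ?R by (simp add: solution_def skew_field_def)
next
  assume ?R
  then have "((\<lambda>t. (fst (z t), snd (z t))) has_vector_derivative skew_field f A (z t)) (at t within {0..})"
    if "t \<ge> 0" for t
    unfolding skew_field_def solution_def using that by (intro has_vector_derivative_Pair) auto
  then show ?L by (simp add: solution_def)
qed

lemma skew_solution_scale: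
  assumes "solution (skew_field f A) z"
  shows "solution (skew_field f A) (\<lambda>t. (fst (z t), c *\<^sub>R snd (z t)))"
  using assms unfolding solution_skew_field_iff
  by (auto intro!: derivative_eq_intros simp: blinfun.scaleR_right)

locale compact_cocycle =
  fixes f :: "'a::euclidean_space \<Rightarrow> 'a" and A :: "'a \<Rightarrow> 'b::euclidean_space \<Rightarrow>\<^sub>L 'b" and S
  assumes compact: "compact S" and C1: "C1_on S f" "C1_on S A"
    and solution_exists: "\<And>x0. x0 \<in> S \<Longrightarrow> \<exists>x. solution f x \<and> x 0 = x0"
    and invariant: "\<And>x t. solution f x \<Longrightarrow> x 0 \<in> S \<Longrightarrow> t \<ge> 0 \<Longrightarrow> x t \<in> S"
begin

lemma coefficient_bound:
  obtains M where "M > 0" "\<And>x. x \<in> S \<Longrightarrow> norm (A x) \<le> M"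
proof -
  have "bounded (A ` S)"
    using compact C1_on_continuous_on[OF C1(2)] by (intro compact_imp_bounded compact_continuous_image)
  then show thesis using that unfolding bounded_pos by blast
qed

lemma fst_solution_in:
  assumes "solution (skew_field f A) z" "fst (z 0) \<in> S" "t \<ge> 0"
  shows "fst (z t) \<in> S"
  using invariant[of "\<lambda>t. fst (z t)" t] assms unfolding solution_skew_field_iff by auto

lemma snd_solution_growth:
  assumes z: "solution (skew_field f A) z" "fst (z 0) \<in> S" and "t \<ge> 0"
    and M: "\<And>x. x \<in> S \<Longrightarrow> norm (A x) \<le> M"
  shows "norm (snd (z t)) \<le> exp (M * t) * norm (snd (z 0))"
proof (rule gronwall_norm(1)[where g' = "\<lambda>s. A (fst (z s)) (snd (z s))"])
  fix s assume s: "s \<in> {0..t}"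
  have "((\<lambda>t. snd (z t)) has_vector_derivative A (fst (z s)) (snd (z s))) (at s within {0..})"
    using z(1) s unfolding solution_skew_field_iff by auto
  then show "((\<lambda>t. snd (z t)) has_vector_derivative A (fst (z s)) (snd (z s))) (at s within {0..t})"
    by (rule has_vector_derivative_within_subset) auto
  show "norm (A (fst (z s)) (snd (z s))) \<le> M * norm (snd (z s))"
    by (rule order_trans[OF norm_blinfun mult_right_mono[OF M]])
      (use fst_solution_in[OF z] s in auto)
qed (use \<open>t \<ge> 0\<close> in auto)

lemma skew_solution_exists:
  assumes x: "solution f x" "x 0 \<in> S"
  obtains w where "w 0 = w0" "solution (skew_field f A) (\<lambda>t. (x t, w t))"
proof -
  obtain M where M: "\<And>x. x \<in> S \<Longrightarrow> norm (A x) \<le> M" using coefficient_bound by metis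
  have "continuous_on {0..} (\<lambda>t. A (x t))"
    by (rule continuous_on_compose2[OF C1_on_continuous_on[OF C1(2)] solution_continuous_on[OF x(1)]])
      (use invariant[OF x] in auto)
  moreover have "norm (A (x t)) \<le> M" if "t \<ge> 0" for t
    using M invariant[OF x that] by simp
  ultimately obtain w where "w 0 = w0" "\<And>t. t \<ge> 0 \<Longrightarrow> (w has_vector_derivative A (x t) (w t)) (at t within {0..})"
    using linear_ode_solution_exists[of "\<lambda>t. A (x t)" M w0] by metis
  then show thesis using x that[of w] by (simp add: solution_skew_field_iff)
qed

text \<open>The fibre is not compact, but solutions with initial vector in the unit ball stay in one
  compact set up to time \<open>T\<close>. There the Lipschitz and Euler constants are uniform;
  other vectors are reached by scaling.\<close>

lemma skew_solution_bounded_region: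
  assumes "T \<ge> 0"
  obtains K where "compact K" "C1_on K (skew_field f A)"
    "\<And>z t. solution (skew_field f A) z \<Longrightarrow> fst (z 0) \<in> S \<Longrightarrow> norm (snd (z 0)) \<le> 1 \<Longrightarrow> t \<in> {0..T} \<Longrightarrow> z t \<in> K"
proof -
  obtain M where M: "M > 0" "\<And>x. x \<in> S \<Longrightarrow> norm (A x) \<le> M" using coefficient_bound by metis
  show thesis
  proof (rule that[of "S \<times> cball 0 (exp (M * T))"])
    show "compact (S \<times> cball (0::'b) (exp (M * T)))" by (intro compact_Times compact compact_cball)
    show "C1_on (S \<times> cball 0 (exp (M * T))) (skew_field f A)"
      by (rule C1_on_subset[OF C1_on_skew_field[OF C1]]) auto
    fix z t assume z: "solution (skew_field f A) z" "fst (z 0) \<in> S" "norm (snd (z 0)) \<le> 1" and t: "t \<in> {0..T}"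
    have "norm (snd (z t)) \<le> exp (M * t) * norm (snd (z 0))"
      by (rule snd_solution_growth) (use z t M in auto)
    also have "\<dots> \<le> exp (M * T) * 1" using z t M by (intro mult_mono) auto
    finally have "snd (z t) \<in> cball 0 (exp (M * T))" by simp
    moreover have "fst (z t) \<in> S" using fst_solution_in z t by simp
    ultimately show "z t \<in> S \<times> cball 0 (exp (M * T))" by (simp add: mem_Times_iff)
  qed
qed

text \<open>Continuous dependence on the base point: a nearby solution with the same initial vector
  deviates by at most 1/4 at time \<open>T\<close>, which is the slack between 1/4 and 1/2.
  Linearity in the fibre removes the restriction to the unit ball.\<close>

lemma contraction_nearby:
  assumes "T \<ge> 0"
    and "\<And>w0. norm w0 \<le> 1 \<Longrightarrow> \<exists>z. solution (skew_field f A) z \<and> z 0 = (x0, w0) \<and> norm (snd (z T)) \<le> 1/4"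
    and "x0 \<in> S"
  obtains d where "d > 0" "\<And>z. solution (skew_field f A) z \<Longrightarrow> fst (z 0) \<in> S \<Longrightarrow> dist x0 (fst (z 0)) < d \<Longrightarrow>
      norm (snd (z T)) \<le> 1/2 * norm (snd (z 0))"
proof -
  let ?F = "skew_field f A"
  obtain K where K: "compact K" "C1_on K ?F"
    "\<And>z t. solution ?F z \<Longrightarrow> fst (z 0) \<in> S \<Longrightarrow> norm (snd (z 0)) \<le> 1 \<Longrightarrow> t \<in> {0..T} \<Longrightarrow> z t \<in> K"
    using skew_solution_bounded_region[OF assms(1)] by metis
  obtain L where L: "\<And>x y. x \<in> K \<Longrightarrow> y \<in> K \<Longrightarrow> norm (?F x - ?F y) \<le> L * norm (x - y)"
    using C1_on_compact_lipschitz[OF K(2,1)] by metis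
  \<comment> \<open>Gronwall magnifies initial distances by at most \<open>exp (L * T)\<close>,
    which leaves 1/4.\<close>
  let ?d = "exp (- (L * T)) / 4"
  have unit: "norm (snd (z T)) \<le> 1/2"
    if z: "solution ?F z" "fst (z 0) \<in> S" "dist x0 (fst (z 0)) < ?d" "norm (snd (z 0)) \<le> 1" for z
  proof -
    obtain y where y: "solution ?F y" "y 0 = (x0, snd (z 0))" "norm (snd (y T)) \<le> 1/4"
      using assms(2)[OF z(4)] by blast
    have "norm (z T - y T) \<le> exp (L * T) * norm (z 0 - y 0)"
    proof (rule gronwall_norm(1)[where g' = "\<lambda>t. ?F (z t) - ?F (y t)"])
      fix t assume t: "t \<in> {0..T}"
      show "((\<lambda>t. z t - y t) has_vector_derivative ?F (z t) - ?F (y t)) (at t within {0..T})"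
        by (intro has_vector_derivative_diff solutionD[OF _ t] z y) auto
      show "norm (?F (z t) - ?F (y t)) \<le> L * norm (z t - y t)"
        by (intro L K(3)) (use z y t assms(3) in auto)
    qed (use assms(1) in auto)
    also have "norm (z 0 - y 0) = dist x0 (fst (z 0))"
      by (cases "z 0") (simp add: y(2) norm_Pair dist_norm norm_minus_commute)
    also have "exp (L * T) * dist x0 (fst (z 0)) \<le> exp (L * T) * ?d"
      using z(3) by (intro mult_left_mono) auto
    also have "\<dots> = 1/4" by (simp flip: exp_add)
    finally have "norm (z T - y T) \<le> 1/4" .
    moreover have "norm (snd (z T - y T)) \<le> norm (z T - y T)"
      by (metis norm_snd_le prod.collapse)
    ultimately have "norm (snd (z T) - snd (y T)) \<le> 1/4" by simp
    then show ?thesis using y(3) norm_triangle_sub[of "snd (z T)" "snd (y T)"] by linarith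
  qed
  show thesis
  proof (rule that[of ?d])
    fix z assume z: "solution ?F z" "fst (z 0) \<in> S" "dist x0 (fst (z 0)) < ?d"
    show "norm (snd (z T)) \<le> 1/2 * norm (snd (z 0))"
    proof (cases "snd (z 0) = 0")
      \<comment> \<open>The zero vector cannot be normalised; the growth bound keeps it at
        zero.\<close>
      case True
      obtain M where "\<And>x. x \<in> S \<Longrightarrow> norm (A x) \<le> M" using coefficient_bound by metis
      from snd_solution_growth[OF z(1,2) assms(1) this] True show ?thesis by simp
    next
      case False
      let ?c = "1 / norm (snd (z 0))"
      have "norm (?c *\<^sub>R snd (z T)) \<le> 1/2"
        using unit[OF skew_solution_scale[OF z(1), of ?c]] z False by simp
      then show ?thesis using False by (simp add: field_simps)
    qed
  qed simp
qed

text \<open>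
  Pointwise contraction times depend on the starting point; by compactness finitely many suffice,
  and cutting an orbit into pieces of these lengths gives a uniform exponential rate.
\<close>

lemma uniform_contraction:
  assumes pointwise: "\<And>x0. x0 \<in> S \<Longrightarrow> \<exists>T\<ge>1. \<forall>w0. norm w0 \<le> 1 \<longrightarrow>
      (\<exists>z. solution (skew_field f A) z \<and> z 0 = (x0, w0) \<and> norm (snd (z T)) \<le> 1/4)"
  obtains T where "T > 0" "\<And>z. solution (skew_field f A) z \<Longrightarrow> fst (z 0) \<in> S \<Longrightarrow>
      norm (snd (z T)) \<le> 1/2 * norm (snd (z 0))"
proof -
  let ?F = "skew_field f A"
  have "\<exists>T d. T \<ge> 1 \<and> d > 0 \<and> (\<forall>z. solution ?F z \<longrightarrow> fst (z 0) \<in> S \<longrightarrow> dist x0 (fst (z 0)) < d \<longrightarrow>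
      norm (snd (z T)) \<le> 1/2 * norm (snd (z 0)))" if x0: "x0 \<in> S" for x0
  proof -
    obtain T where T: "T \<ge> 1" "\<And>w0. norm w0 \<le> 1 \<Longrightarrow>
      \<exists>z. solution ?F z \<and> z 0 = (x0, w0) \<and> norm (snd (z T)) \<le> 1/4"
      using pointwise[OF x0] by blast
    obtain d where "d > 0" "\<And>z. solution ?F z \<Longrightarrow> fst (z 0) \<in> S \<Longrightarrow> dist x0 (fst (z 0)) < d \<Longrightarrow>
      norm (snd (z T)) \<le> 1/2 * norm (snd (z 0))"
      using contraction_nearby[OF _ T(2) x0] T(1) by auto
    with T(1) show ?thesis by blast
  qed
  then obtain \<tau> \<delta> where \<tau>: "\<And>x0. x0 \<in> S \<Longrightarrow> \<tau> x0 \<ge> 1" and \<delta>: "\<And>x0. x0 \<in> S \<Longrightarrow> \<delta> x0 > 0"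
    and con: "\<And>x0 z. x0 \<in> S \<Longrightarrow> solution ?F z \<Longrightarrow> fst (z 0) \<in> S \<Longrightarrow> dist x0 (fst (z 0)) < \<delta> x0 \<Longrightarrow>
      norm (snd (z (\<tau> x0))) \<le> 1/2 * norm (snd (z 0))"
    by metis
  obtain C where C: "C \<subseteq> S" "finite C" "S \<subseteq> (\<Union>x\<in>C. ball x (\<delta> x))"
    by (rule compactE_image[OF compact, of S "\<lambda>x. ball x (\<delta> x)"]) (use \<delta> in auto)
  \<comment> \<open>The inserted 1 makes the maximum meaningful for an empty cover.\<close>
  define R where "R = Max (insert 1 (\<tau> ` C))"
  have R1: "R \<ge> 1" unfolding R_def using C by (intro Max_ge) auto
  have R: "\<tau> x \<le> R" if "x \<in> C" for x unfolding R_def using C that by (intro Max_ge) auto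
  obtain M where M: "M > 0" "\<And>x. x \<in> S \<Longrightarrow> norm (A x) \<le> M" using coefficient_bound by metis
  \<comment> \<open>A piece of length at most \<open>R\<close> halves the norm, which is at least as
    good as decay at rate \<open>g\<close>.\<close>
  define g where "g = ln 2 / R"
  have g: "g > 0" using R1 by (simp add: g_def)
  \<comment> \<open>Pays for the last, incomplete piece: growth at rate \<open>M\<close>, and the
    decay at rate \<open>g\<close> that is missing, over a time of at most \<open>R\<close>.\<close>
  define Q where "Q = exp ((M + g) * R)"
  \<comment> \<open>Every piece has length at least 1, so removing one lowers the integer bound
    \<open>n\<close> on the remaining time; this makes the induction terminate.\<close>
  have decay: "norm (snd (z t)) \<le> Q * exp (- g * t) * norm (snd (z 0))"
    if "solution ?F z" "fst (z 0) \<in> S" "0 \<le> t" "t \<le> real n" for z t n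
    using that
  proof (induction n arbitrary: z t)
    case 0
    have "Q \<ge> 1" unfolding Q_def using M g R1 by simp
    then show ?case using 0 mult_right_mono[of 1 Q "norm (snd (z 0))"] by simp
  next
    case (Suc n)
    show ?case
    proof (cases "t \<le> R")
      case True
      have "norm (snd (z t)) \<le> exp (M * t) * norm (snd (z 0))"
        by (rule snd_solution_growth) (use Suc.prems M in auto)
      also have "exp (M * t) \<le> Q * exp (- g * t)"
        using True M g mult_left_mono[of t R "M + g"] unfolding Q_def
        by (simp add: algebra_simps flip: exp_add)
      finally show ?thesis by (simp add: mult_right_mono)
    next
      case False
      obtain x0 where x0: "x0 \<in> C" "dist x0 (fst (z 0)) < \<delta> x0" using C(3) Suc.prems(2) by auto
      let ?s = "\<tau> x0"
      have s: "1 \<le> ?s" "?s \<le> R" using \<tau> R x0 C(1) by auto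
      have "norm (snd (z (?s + (t - ?s)))) \<le> Q * exp (- g * (t - ?s)) * norm (snd (z (?s + 0)))"
        by (rule Suc.IH[OF solution_shift[OF Suc.prems(1)]])
          (use fst_solution_in[OF Suc.prems(1,2)] s False Suc.prems(4) in auto)
      also have "\<dots> \<le> Q * exp (- g * (t - ?s)) * (1/2 * norm (snd (z 0)))"
        using con[OF _ Suc.prems(1,2) x0(2)] x0 C(1) by (intro mult_left_mono) (auto simp: Q_def)
      also have "\<dots> = Q * exp (- g * t) * norm (snd (z 0)) * (exp (g * ?s) / 2)"
        by (simp add: algebra_simps exp_diff exp_minus field_simps)
      also have "\<dots> \<le> Q * exp (- g * t) * norm (snd (z 0)) * 1"
      proof (rule mult_left_mono)
        have "g * ?s \<le> g * R" using s g by (intro mult_left_mono) auto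
        also have "\<dots> = ln 2" using R1 by (simp add: g_def)
        finally have "exp (g * ?s) \<le> exp (ln 2)" by (simp only: exp_le_cancel_iff)
        then show "exp (g * ?s) / 2 \<le> 1" by simp
      qed (simp add: Q_def)
      finally show ?thesis by simp
    qed
  qed
  \<comment> \<open>The solution of \<open>Q * exp (- g * T) = 1/2\<close>.\<close>
  define T where "T = ((M + g) * R + ln 2) / g"
  have T: "T > 0" unfolding T_def using M g R1 by (intro divide_pos_pos add_pos_pos) auto
  have "Q * exp (- g * T) = exp ((M + g) * R + - ((M + g) * R + ln 2))"
    unfolding Q_def T_def exp_add[symmetric] using g by simp
  also have "\<dots> = 1/2" by (simp add: exp_minus)
  finally have QT: "Q * exp (- g * T) = 1/2" .
  show thesis
  proof (rule that[OF T])
    fix z assume z: "solution ?F z" "fst (z 0) \<in> S"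
    obtain n where "T \<le> real n" using real_arch_simple by blast
    from decay[OF z _ this] T show "norm (snd (z T)) \<le> 1/2 * norm (snd (z 0))"
      unfolding QT by simp
  qed
qed

end

section \<open>Euler iterates of the skew product and the Lyapunov sum\<close>

lemma fst_skew_field: "fst (skew_field f A p) = f (fst p)"
  and snd_skew_field: "snd (skew_field f A p) = A (fst p) (snd p)"
  by (simp_all add: skew_field_def)

text \<open>The base iterates do not see \<open>w\<close>, so each step acts on the fibre by a fixed
  linear map. Hence the Lyapunov sum is a quadratic form in \<open>w\<close>.\<close>

lemma linear_snd_euler_skew:
  fixes A :: "'a::real_normed_vector \<Rightarrow> 'b::real_normed_vector \<Rightarrow>\<^sub>L 'b"
  shows "linear (\<lambda>w. snd ((euler_step (skew_field f A) h ^^ i) (x, w)))"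
    and "fst ((euler_step (skew_field f A) h ^^ i) (x, w)) = (euler_step f h ^^ i) x"
proof -
  have fst: "fst ((euler_step (skew_field f A) h ^^ i) (x, w)) = (euler_step f h ^^ i) x" for w i
    by (induction i) (simp_all add: euler_Suc fst_skew_field del: funpow.simps(2))
  show "fst ((euler_step (skew_field f A) h ^^ i) (x, w)) = (euler_step f h ^^ i) x"
    by (rule fst)
  show "linear (\<lambda>w. snd ((euler_step (skew_field f A) h ^^ i) (x, w)))"
  proof (induction i)
    case 0
    show ?case by (simp add: linear_iff)
  next
    case (Suc i)
    then show ?case
      by (simp add: euler_Suc snd_skew_field fst linear_compose_add linear_compose_scale_right
          linear_compose[unfolded o_def, OF _ bounded_linear.linear[OF blinfun.bounded_linear_right]]
          del: funpow.simps(2))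
  qed
qed

text \<open>The neighbourhood in the definition serves its own points too, which gives regularity at
  Euler points that have left \<open>S\<close>.\<close>

lemma C1_on_open_neighbourhood:
  assumes "C1_on S f"
  obtains \<Omega> where "open \<Omega>" "S \<subseteq> \<Omega>" "C1_on \<Omega> f"
proof -
  obtain \<Omega> f' where *: "open \<Omega>" "S \<subseteq> \<Omega>"
    "\<And>x. x \<in> \<Omega> \<Longrightarrow> (f has_derivative blinfun_apply (f' x)) (at x)" "continuous_on \<Omega> f'"
    using C1_onE[OF assms] by metis
  have "C1_on \<Omega> f"
    unfolding C1_on_def by (rule exI[of _ \<Omega>], rule exI[of _ f']) (simp add: *)
  with * that show thesis by blast
qed

context compact_cocycle
begin

text \<open>
  With \<open>w\<^sub>i\<close> the second components of the Euler iterates, the sum of \<open>|w\<^sub>i|\<^sup>2\<close> over \<open>i < N\<close>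
  telescopes along the field up to the error of the Euler flow property:
  its derivative is at most \<open>(|w\<^sub>N|\<^sup>2 - |w\<^sub>0|\<^sup>2 + small) / h\<close>.
\<close>

lemma euler_lyapunov:
  assumes "T > 0"
    and contraction: "\<And>z. solution (skew_field f A) z \<Longrightarrow> fst (z 0) \<in> S \<Longrightarrow>
      norm (snd (z T)) \<le> 1/2 * norm (snd (z 0))"
  obtains h N where "N > (0::nat)"
    "\<And>i. i \<le> N \<Longrightarrow> C1_on (S \<times> UNIV) (euler_step (skew_field f A) h ^^ i)"
    "\<And>x w. x \<in> S \<Longrightarrow> \<exists>V'.
      ((\<lambda>p. \<Sum>i<N. (norm (snd ((euler_step (skew_field f A) h ^^ i) p)))\<^sup>2) has_derivative V') (at (x, w)) \<and>
      V' (skew_field f A (x, w)) \<le> 0"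
proof -
  let ?F = "skew_field f A"
  obtain \<Omega>1 \<Omega>2 where \<Omega>12: "open \<Omega>1" "S \<subseteq> \<Omega>1" "C1_on \<Omega>1 f" "open \<Omega>2" "S \<subseteq> \<Omega>2" "C1_on \<Omega>2 A"
    using C1_on_open_neighbourhood[OF C1(1)] C1_on_open_neighbourhood[OF C1(2)] by metis
  define \<Omega> where "\<Omega> = \<Omega>1 \<inter> \<Omega>2"
  have \<Omega>: "open \<Omega>" "S \<subseteq> \<Omega>" "C1_on \<Omega> f" "C1_on \<Omega> A"
    using \<Omega>12 by (auto simp: \<Omega>_def intro: C1_on_subset)
  obtain r K' where r: "r > 0" "K' \<subseteq> \<Omega>" "\<And>x. x \<in> S \<Longrightarrow> cball x r \<subseteq> K'"
    using compact_neighbourhood_within[OF compact \<Omega>(1,2)] by metis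
  obtain M where M: "M > 0" "\<And>x. x \<in> S \<Longrightarrow> norm (A x) \<le> M" using coefficient_bound by metis
  \<comment> \<open>Bounds all fibre iterates of unit vectors: the growth of the exact solution,
    plus 1 for the Euler error.\<close>
  define R where "R = exp (M * T) + 1"
  have R: "R > 0" by (simp add: R_def add_pos_pos)
  \<comment> \<open>The three entries keep the base iterates in \<open>\<Omega>\<close>, give |w_N|
    at most 1/2 + 1/4, and hold the accumulated flow error, after multiplication by
    \<open>h\<close>, below 1/4.\<close>
  define e where "e = Min {r, 1/4, 1 / (8 * T * R)}"
  have e: "e > 0" "e \<le> r" "e \<le> 1/4" "e \<le> 1 / (8 * T * R)"
    using r R \<open>T > 0\<close> by (auto simp: e_def)
  have eTR: "e * (T * R) \<le> 1/8" using e(4) R \<open>T > 0\<close> by (simp add: field_simps)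
  obtain K where K: "compact K" "C1_on K ?F"
    "\<And>z t. solution ?F z \<Longrightarrow> fst (z 0) \<in> S \<Longrightarrow> norm (snd (z 0)) \<le> 1 \<Longrightarrow> t \<in> {0..T} \<Longrightarrow> z t \<in> K"
    using skew_solution_bounded_region[of T] \<open>T > 0\<close> by (metis less_imp_le)
  obtain h0 where h0: "h0 > 0"
    "\<And>h z j. 0 < h \<Longrightarrow> h \<le> h0 \<Longrightarrow> solution ?F z \<Longrightarrow> (\<And>t. t \<in> {0..T} \<Longrightarrow> z t \<in> K) \<Longrightarrow> real j * h \<le> T \<Longrightarrow>
       norm ((euler_step ?F h ^^ j) (z 0) - z (real j * h)) \<le> e \<and>
       (\<exists>D. ((euler_step ?F h ^^ j) has_derivative D) (at (z 0)) \<and>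
          norm (D (?F (z 0)) - ?F ((euler_step ?F h ^^ j) (z 0))) \<le> e)"
    using euler_approximation[OF K(2,1) e(1) less_imp_le[OF \<open>T > 0\<close>]] by blast
  obtain N where N': "max 1 (T / h0) \<le> real N" using real_arch_simple by blast
  then have N: "N > 0" "T / h0 \<le> real N" by auto
  \<comment> \<open>\<open>N\<close> steps end exactly at time \<open>T\<close>, where the
    contraction is available.\<close>
  define h where "h = T / real N"
  have h: "h > 0" "h \<le> h0" "real N * h = T" using N h0(1) \<open>T > 0\<close> by (auto simp: h_def field_simps)
  let ?E = "\<lambda>i. euler_step ?F h ^^ i"
  define V where "V p = (\<Sum>i<N. (norm (snd (?E i p)))\<^sup>2)" for p
  have approx: "\<exists>z. solution ?F z \<and> z 0 = (x, w) \<and> (\<forall>i\<le>N. norm (?E i (x, w) - z (real i * h)) \<le> e \<and>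
      (\<exists>D. (?E i has_derivative D) (at (x, w)) \<and> norm (D (?F (x, w)) - ?F (?E i (x, w))) \<le> e))"
    if x: "x \<in> S" and w: "norm w \<le> 1" for x w
  proof -
    obtain \<xi> where \<xi>: "solution f \<xi>" "\<xi> 0 = x" using solution_exists[OF x] by blast
    obtain \<omega> where \<omega>: "\<omega> 0 = w" "solution ?F (\<lambda>t. (\<xi> t, \<omega> t))"
      using skew_solution_exists[OF \<xi>(1), of w] \<xi>(2) x by blast
    have "real i * h \<le> T" if "i \<le> N" for i
      using that h mult_right_mono[of "real i" "real N" h] by simp
    with h0(2)[OF h(1,2) \<omega>(2) K(3)[OF \<omega>(2)]] show ?thesis
      using \<xi>(2) \<omega> x w by (intro exI[of _ "\<lambda>t. (\<xi> t, \<omega> t)"]) simp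
  qed
  \<comment> \<open>The approximation covers only the unit ball of the fibre; as the base component
    is independent of \<open>w\<close>, the case \<open>w = 0\<close> settles all
    \<open>w\<close>.\<close>
  have in_\<Omega>: "fst (?E i (x, w)) \<in> \<Omega>" if x: "x \<in> S" and i: "i \<le> N" for x i and w :: 'b
  proof -
    obtain z where z: "solution ?F z" "z 0 = (x, 0)" "norm (?E i (x, 0) - z (real i * h)) \<le> e"
      using approx[OF x, of 0] i by auto
    have S: "fst (z (real i * h)) \<in> S" by (rule fst_solution_in[OF z(1)]) (use z x h in auto)
    have "norm (fst (?E i (x, 0) - z (real i * h))) \<le> norm (?E i (x, 0) - z (real i * h))"
      by (metis norm_fst_le prod.collapse)
    then have "fst (?E i (x, 0)) \<in> cball (fst (z (real i * h))) r"
      using z(3) e(2) by (simp add: dist_norm norm_minus_commute)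
    then show ?thesis using r(2) r(3)[OF S] by (auto simp: linear_snd_euler_skew(2))
  qed
  \<comment> \<open>The Euler errors do not scale with \<open>w\<close>, so they are compared with a
    fixed margin on unit vectors. At \<open>w = 0\<close> all fibre iterates vanish.\<close>
  have unit: "\<exists>V'. (V has_derivative V') (at (x, w)) \<and> V' (?F (x, w)) \<le> 0"
    if x: "x \<in> S" and w: "norm w = 1 \<or> w = 0" for x w
  proof -
    have w1: "norm w \<le> 1" using w by auto
    obtain z where z: "solution ?F z" "z 0 = (x, w)" and
      close: "\<And>i. i \<le> N \<Longrightarrow> norm (?E i (x, w) - z (real i * h)) \<le> e" and
      "\<And>i. i \<le> N \<Longrightarrow> \<exists>D. (?E i has_derivative D) (at (x, w)) \<and> norm (D (?F (x, w)) - ?F (?E i (x, w))) \<le> e"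
      using approx[OF x w1] by blast
    then obtain D where D: "\<And>i. i \<le> N \<Longrightarrow> (?E i has_derivative D i) (at (x, w))"
      "\<And>i. i \<le> N \<Longrightarrow> norm (D i (?F (x, w)) - ?F (?E i (x, w))) \<le> e"
      by metis
    define W where "W i = snd (?E i (x, w))" for i
    define V' where "V' v = (\<Sum>i<N. 2 * (W i \<bullet> snd (D i v)))" for v
    have "((\<lambda>p. \<Sum>i<N. snd (?E i p) \<bullet> snd (?E i p)) has_derivative V') (at (x, w))"
      unfolding V'_def
    proof (rule has_derivative_sum)
      fix i assume "i \<in> {..<N}"
      then have "((\<lambda>p. snd (?E i p)) has_derivative (\<lambda>v. snd (D i v))) (at (x, w))"
        by (intro has_derivative_snd D) auto
      from has_derivative_inner[OF this this]
      show "((\<lambda>p. snd (?E i p) \<bullet> snd (?E i p)) has_derivative (\<lambda>v. 2 * (W i \<bullet> snd (D i v)))) (at (x, w))"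
        by (simp add: W_def inner_commute)
    qed
    then have der: "(V has_derivative V') (at (x, w))"
      by (simp add: V_def[abs_def] dot_square_norm)
    have increment: "2 * (W i \<bullet> snd (D i (?F (x, w)))) \<le> ((norm (W (Suc i)))\<^sup>2 - (norm (W i))\<^sup>2) / h + 2 * e * norm (W i)"
      if i: "i < N" for i
    proof -
      let ?a = "snd (?F (?E i (x, w)))" and ?b = "snd (D i (?F (x, w)))"
      have WS: "W (Suc i) = W i + h *\<^sub>R ?a" by (simp add: W_def euler_Suc del: funpow.simps)
      have "(norm (W (Suc i)))\<^sup>2 - (norm (W i))\<^sup>2 = h * (2 * (W i \<bullet> ?a)) + (norm (h *\<^sub>R ?a))\<^sup>2"
        unfolding WS by (simp add: power2_eq_square[of h] power2_norm_eq_inner inner_simps inner_commute algebra_simps)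
      then have "h * (2 * (W i \<bullet> ?a)) \<le> (norm (W (Suc i)))\<^sup>2 - (norm (W i))\<^sup>2"
        using zero_le_power2[of "norm (h *\<^sub>R ?a)"] by linarith
      then have 1: "2 * (W i \<bullet> ?a) \<le> ((norm (W (Suc i)))\<^sup>2 - (norm (W i))\<^sup>2) / h"
        using h(1) by (simp add: field_simps)
      have "norm (?b - ?a) \<le> norm (D i (?F (x, w)) - ?F (?E i (x, w)))"
        by (metis norm_snd_le prod.collapse snd_diff)
      also have "\<dots> \<le> e" using D(2)[of i] i by simp
      finally have "norm (?b - ?a) \<le> e" .
      then have "W i \<bullet> (?b - ?a) \<le> norm (W i) * e"
        by (intro order_trans[OF norm_cauchy_schwarz] mult_left_mono) auto
      with 1 show ?thesis by (simp add: inner_diff_right algebra_simps)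
    qed
    have "V' (?F (x, w)) \<le> (\<Sum>i<N. ((norm (W (Suc i)))\<^sup>2 - (norm (W i))\<^sup>2) / h + 2 * e * norm (W i))"
      unfolding V'_def by (intro sum_mono increment) simp
    also have "\<dots> = ((norm (W N))\<^sup>2 - (norm w)\<^sup>2) / h + 2 * e * (\<Sum>i<N. norm (W i))"
      using sum_lessThan_telescope[of "\<lambda>i. (norm (W i))\<^sup>2" N]
      by (simp add: sum.distrib flip: sum_divide_distrib sum_distrib_left W_def) (simp add: W_def)
    also have "\<dots> \<le> 0"
    proof (cases "w = 0")
      case True
      then have "W i = 0" for i
        unfolding W_def using linear_0[OF linear_snd_euler_skew(1)] by simp
      then show ?thesis using True by simp
    next
      case False
      then have nw: "norm w = 1" using w by simp
      have diff: "norm (W i - snd (z (real i * h))) \<le> e" if "i \<le> N" for i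
      proof -
        have "norm (snd (?E i (x, w) - z (real i * h))) \<le> norm (?E i (x, w) - z (real i * h))"
          by (metis norm_snd_le prod.collapse)
        with close[OF that] show ?thesis by (simp add: W_def)
      qed
      have WR: "norm (W i) \<le> R" if i: "i < N" for i
      proof -
        have iT: "real i * h \<le> T" using i h mult_right_mono[of "real i" "real N" h] by simp
        have "norm (snd (z (real i * h))) \<le> exp (M * (real i * h)) * norm (snd (z 0))"
          by (rule snd_solution_growth[OF z(1)]) (use z x h M in auto)
        also have "\<dots> \<le> exp (M * T) * 1" using z(2) nw M iT by (intro mult_mono) auto
        finally show ?thesis
          using diff[of i] i e(3) norm_triangle_sub[of "W i" "snd (z (real i * h))"] by (simp add: R_def)
      qed
      have "norm (snd (z T)) \<le> 1/2" using contraction[OF z(1)] z(2) x nw by simp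
      then have "norm (W N) \<le> 3/4"
        using diff[of N] h(3) e(3) norm_triangle_sub[of "W N" "snd (z T)"] by simp
      then have WN: "(norm (W N))\<^sup>2 \<le> (3/4)\<^sup>2" by (intro power_mono) auto
      have "(\<Sum>i<N. norm (W i)) \<le> real N * R"
        using sum_bounded_above[of "{..<N}" "\<lambda>i. norm (W i)" R] WR by simp
      then have "2 * e * (\<Sum>i<N. norm (W i)) * h \<le> 2 * e * (real N * R) * h"
        using e(1) h(1) by (intro mult_right_mono mult_left_mono) auto
      also have "\<dots> = 2 * (e * (T * R))" by (simp flip: h(3))
      also have "\<dots> \<le> 1/4" using eTR by simp
      \<comment> \<open>The balance is 9/16 - 1 + 1/4 = -3/16.\<close>
      finally have "((norm (W N))\<^sup>2 - (norm w)\<^sup>2) + 2 * e * (\<Sum>i<N. norm (W i)) * h \<le> 0"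
        using WN nw by (simp add: power2_eq_square)
      then show ?thesis using h(1) by (simp add: field_simps)
    qed
    finally show ?thesis using der by blast
  qed
  \<comment> \<open>\<open>V\<close> has degree two and the fibre part of the field degree one in
    \<open>w\<close>, so the sign of the derivative passes from the unit vector to
    \<open>w\<close>.\<close>
  have scale: "V (x, c *\<^sub>R w) = c\<^sup>2 * V (x, w)" for x c w
    by (simp add: V_def linear_cmul[OF linear_snd_euler_skew(1)] power_mult_distrib sum_distrib_left)
  show thesis
  proof (rule that[OF N(1)])
    fix i assume i: "i \<le> N"
    show "C1_on (S \<times> UNIV) (?E i)"
    proof (rule C1_on_euler[OF C1_on_skew_field[OF \<Omega>(3,4)]])
      fix z l assume "z \<in> S \<times> (UNIV :: 'b set)" "l < i"
      then show "?E l z \<in> \<Omega> \<times> UNIV"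
        using in_\<Omega>[of "fst z" l "snd z"] i by (auto simp: mem_Times_iff)
    qed
  next
    fix x w assume x: "x \<in> S"
    have "\<exists>V'. (V has_derivative V') (at (x, w)) \<and> V' (?F (x, w)) \<le> 0"
    proof (cases "w = 0")
      case False
      define c where "c = norm w"
      have c: "c > 0" using False by (simp add: c_def)
      obtain V' where V': "(V has_derivative V') (at (x, w /\<^sub>R c))" "V' (?F (x, w /\<^sub>R c)) \<le> 0"
        using unit[OF x, of "w /\<^sub>R c"] c by (auto simp: c_def)
      have cc: "c\<^sup>2 * (inverse c)\<^sup>2 = 1" using c by (simp flip: power_mult_distrib)
      have "((\<lambda>p. (fst p, snd p /\<^sub>R c)) has_derivative (\<lambda>p. (fst p, snd p /\<^sub>R c))) (at (x, w))"
        by (intro derivative_intros)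
      from has_derivative_compose[OF this, of V V'] V'(1)
      have "((\<lambda>p. V (fst p, snd p /\<^sub>R c)) has_derivative (\<lambda>v. V' (fst v, snd v /\<^sub>R c))) (at (x, w))"
        by simp
      then have "((\<lambda>p. c\<^sup>2 * V (fst p, snd p /\<^sub>R c)) has_derivative (\<lambda>v. c\<^sup>2 * V' (fst v, snd v /\<^sub>R c))) (at (x, w))"
        by (rule has_derivative_mult_right)
      moreover have "(\<lambda>p. c\<^sup>2 * V (fst p, snd p /\<^sub>R c)) = V"
        using c by (simp add: scale cc fun_eq_iff flip: mult.assoc)
      moreover have "V' (fst (?F (x, w)), snd (?F (x, w)) /\<^sub>R c) \<le> 0"
        using V'(2) by (simp add: skew_field_def blinfun.scaleR_right)
      ultimately show ?thesis by (metis (mono_tags, lifting) mult_nonneg_nonpos zero_le_power2)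
    qed (use unit[OF x] in auto)
    then show "\<exists>V'. ((\<lambda>p. \<Sum>i<N. (norm (snd (?E i p)))\<^sup>2) has_derivative V') (at (x, w)) \<and> V' (?F (x, w)) \<le> 0"
      by (simp add: V_def[abs_def])
  qed
qed
end

section \<open>Additive compounds depend linearly on the matrix\<close>

lemma minor_differentiable:
  fixes A :: "real^'n^'n"
  shows "(\<lambda>A. minor A xs ys) differentiable (at A)"
proof (cases "length xs = length ys")
  case True
  let ?n = "length ys"
  have "minor B xs ys = (\<Sum>p | p permutes {0..<?n}. signof p * (\<Prod>i = 0..<?n. B $ (xs ! i) $ (ys ! p i)))"
    for B :: "real^'n^'n"
  proof -
    have "p i < ?n" if "p permutes {0..<?n}" "i < ?n" for p i
      using permutes_in_image[OF that(1), of i] that(2) by simp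
    then show ?thesis
      unfolding minor_def Determinant.det_def using True by (auto intro!: sum.cong prod.cong)
  qed
  moreover have "(\<lambda>B :: real^'n^'n. \<Sum>p | p permutes {0..<?n}. signof p * (\<Prod>i = 0..<?n. B $ (xs ! i) $ (ys ! p i)))
      differentiable (at A)"
  proof (intro differentiable_sum differentiable_mult differentiable_const ballI)
    fix p :: "nat \<Rightarrow> nat"
    have der: "((\<lambda>B :: real^'n^'n. B $ (xs ! i) $ (ys ! p i)) has_derivative (\<lambda>B. B $ (xs ! i) $ (ys ! p i))) (at A)" for i
      by (rule bounded_linear_imp_has_derivative[OF
            bounded_linear_compose[OF bounded_linear_vec_nth bounded_linear_vec_nth]])
    show "(\<lambda>B :: real^'n^'n. \<Prod>i = 0..<?n. B $ (xs ! i) $ (ys ! p i)) differentiable (at A)"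
      unfolding differentiable_def
      by (rule exI, rule has_derivative_prod, rule der)
  qed (auto simp: finite_permutations)
  ultimately show ?thesis by simp
next
  \<comment> \<open>The determinant of a nonsquare matrix is 0 by definition, so the minor is
    constant.\<close>
  case False
  then show ?thesis by (simp add: minor_def Determinant.det_def)
qed

lemma Basis_matrixE:
  assumes "b \<in> (Basis :: (real^'n^'m) set)"
  obtains i j where "\<And>A :: real^'n^'m. A \<bullet> b = A $ i $ j"
proof -
  obtain i j where "b = axis i (axis j 1)" using assms by (auto simp: Basis_vec_def)
  then show thesis using that[of i j] by (simp add: inner_axis)
qed

text \<open>\<open>add_compound k A\<close> is the derivative of the multiplicative compound at the
  identity in the direction \<open>A\<close>. Minors are polynomials, so the Frechet derivative
  exists there and is linear in the direction; no formula for the entries is needed.\<close>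

lemma bounded_linear_add_compound:
  "bounded_linear (add_compound k :: real^'n::{finite,linorder}^'n::{finite,linorder} \<Rightarrow> real^'m::{finite,linorder}^'m::{finite,linorder})"
proof -
  let ?C = "mult_compound k :: real^'n::{finite,linorder}^'n::{finite,linorder} \<Rightarrow> real^'m::{finite,linorder}^'m::{finite,linorder}"
  have "?C differentiable (at (Finite_Cartesian_Product.mat 1))"
  proof (subst differentiable_componentwise_within, intro ballI)
    fix b :: "real^'m::{finite,linorder}^'m::{finite,linorder}" assume "b \<in> Basis"
    then obtain i j where "\<And>A :: real^'m::{finite,linorder}^'m::{finite,linorder}. A \<bullet> b = A $ i $ j" using Basis_matrixE by blast
    then show "(\<lambda>A. ?C A \<bullet> b) differentiable (at (Finite_Cartesian_Product.mat 1))"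
      using minor_differentiable by (simp add: mult_compound_def)
  qed
  then obtain D where D: "(?C has_derivative D) (at (Finite_Cartesian_Product.mat 1))"
    unfolding differentiable_def by blast
  have "add_compound k A = D A" for A
  proof -
    have "((\<lambda>\<delta>::real. Finite_Cartesian_Product.mat 1 + \<delta> *\<^sub>R A) has_derivative (\<lambda>\<delta>. \<delta> *\<^sub>R A)) (at 0)"
      by (auto intro!: derivative_eq_intros)
    from has_derivative_compose[OF this, of ?C D] D
    have "((\<lambda>\<delta>. ?C (Finite_Cartesian_Product.mat 1 + \<delta> *\<^sub>R A)) has_derivative (\<lambda>\<delta>. D (\<delta> *\<^sub>R A))) (at 0)"
      by simp
    then have "((\<lambda>\<delta>. ?C (Finite_Cartesian_Product.mat 1 + \<delta> *\<^sub>R A)) has_vector_derivative D A) (at 0)"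
      using linear_cmul[OF has_derivative_linear[OF D]] by (simp add: has_vector_derivative_def)
    then show ?thesis unfolding add_compound_def by (rule vector_derivative_at)
  qed
  then have "(add_compound k :: real^'n::{finite,linorder}^'n::{finite,linorder} \<Rightarrow> real^'m::{finite,linorder}^'m::{finite,linorder}) = D" by auto
  with has_derivative_bounded_linear[OF D] show ?thesis by simp
qed

text \<open>Acts on bounded linear maps, the form in which \<open>C1_on\<close> and
  \<open>C2_on\<close> supply derivatives. As a bounded linear map it passes their regularity on to
  the coefficients.\<close>

definition compound_operator ::
  "nat \<Rightarrow> ((real^'n::{finite,linorder}) \<Rightarrow>\<^sub>L (real^'n::{finite,linorder})) \<Rightarrow> ((real^'m::{finite,linorder}) \<Rightarrow>\<^sub>L (real^'m::{finite,linorder}))" where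
  "compound_operator k b = Blinfun ((*v) (add_compound k (matrix (blinfun_apply b))))"

lemma compound_operator_apply:
  "compound_operator k b w = add_compound k (matrix (blinfun_apply b)) *v w"
  unfolding compound_operator_def
  by (subst bounded_linear_Blinfun_apply) (simp_all add: matrix_vector_mul_bounded_linear)

lemma bounded_linear_compound_operator:
  "bounded_linear (compound_operator k :: ((real^'n::{finite,linorder}) \<Rightarrow>\<^sub>L (real^'n::{finite,linorder})) \<Rightarrow> ((real^'m::{finite,linorder}) \<Rightarrow>\<^sub>L (real^'m::{finite,linorder})))"
proof -
  have "bounded_linear (\<lambda>b :: (real^'n::{finite,linorder}) \<Rightarrow>\<^sub>L (real^'n::{finite,linorder}). matrix (blinfun_apply b))"
  proof (subst bounded_linear_componentwise_iff, intro ballI)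
    fix b :: "real^'n::{finite,linorder}^'n::{finite,linorder}" assume "b \<in> Basis"
    then obtain i j where "\<And>A :: real^'n::{finite,linorder}^'n::{finite,linorder}. A \<bullet> b = A $ i $ j" using Basis_matrixE by blast
    moreover have "bounded_linear (\<lambda>b :: (real^'n::{finite,linorder}) \<Rightarrow>\<^sub>L (real^'n::{finite,linorder}). b (axis j 1) $ i)"
      by (rule bounded_linear_compose[OF bounded_linear_vec_nth blinfun.bounded_linear_left])
    ultimately show "bounded_linear (\<lambda>x :: (real^'n::{finite,linorder}) \<Rightarrow>\<^sub>L (real^'n::{finite,linorder}). matrix (blinfun_apply x) \<bullet> b)"
      by (simp add: matrix_def)
  qed
  then have 1: "bounded_linear (\<lambda>b :: (real^'n::{finite,linorder}) \<Rightarrow>\<^sub>L (real^'n::{finite,linorder}). add_compound k (matrix (blinfun_apply b)) :: real^'m::{finite,linorder}^'m::{finite,linorder})"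
    by (rule bounded_linear_compose[OF bounded_linear_add_compound])
  have app: "blinfun_apply (Blinfun ((*v) M)) = (*v) M" for M :: "real^'m::{finite,linorder}^'m::{finite,linorder}"
    by (simp add: bounded_linear_Blinfun_apply matrix_vector_mul_bounded_linear)
  have "linear (\<lambda>M :: real^'m::{finite,linorder}^'m::{finite,linorder}. Blinfun ((*v) M))"
    by (intro linearI blinfun_eqI)
      (simp_all add: app blinfun.bilinear_simps matrix_vector_mult_add_rdistrib scaleR_matrix_vector_assoc)
  then have "bounded_linear (\<lambda>M :: real^'m::{finite,linorder}^'m::{finite,linorder}. Blinfun ((*v) M))"
    by (simp add: linear_conv_bounded_linear)
  from bounded_linear_compose[OF this 1] show ?thesis
    by (simp add: compound_operator_def[abs_def])
qed

lemma Df_compound_eq: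
  assumes "(f has_derivative blinfun_apply f') (at x)"
  shows "Df_compound k f x *v w = compound_operator k f' w"
  by (simp add: Df_compound_def compound_operator_apply jacobian_def flip: frechet_derivative_at[OF assms])

text \<open>\<open>gradient\<close> is a definite description, so a representing vector has to be
  exhibited and shown unique; it is the Riesz vector of \<open>g'\<close>.\<close>

lemma inner_gradient:
  fixes g :: "'a::euclidean_space \<Rightarrow> real"
  assumes "(g has_derivative g') (at x)"
  shows "h \<bullet> gradient g x = g' h"
proof -
  define D where "D = (\<Sum>b\<in>Basis. g' b *\<^sub>R b)"
  have g': "g' h = h \<bullet> D" for h
  proof -
    have "g' h = g' (\<Sum>b\<in>Basis. (h \<bullet> b) *\<^sub>R b)" by (simp add: euclidean_representation)
    also have "\<dots> = (\<Sum>b\<in>Basis. (h \<bullet> b) *\<^sub>R g' b)"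
      using has_derivative_linear[OF assms] by (simp add: linear_sum linear_cmul)
    finally show ?thesis by (simp add: D_def inner_sum_right mult.commute)
  qed
  have "gradient g x = D"
    unfolding gradient_def
  proof (rule the_equality)
    show "GDERIV g x :> D" using assms by (simp add: gderiv_def g'[abs_def, symmetric])
    fix E assume "GDERIV g x :> E"
    then have "g' = (\<lambda>h. h \<bullet> E)"
      unfolding gderiv_def by (rule has_derivative_unique[OF assms])
    then have "h \<bullet> E = h \<bullet> D" for h using g'[of h] by metis
    then show "E = D" by (metis vector_eq_ldot)
  qed
  then show ?thesis by (simp add: g')
qed

text \<open>Reads the sum of the two partial terms in \<open>admissible\<close> as the derivative of
  \<open>V\<close> along the skew field.\<close>

lemma inner_gradient_Pair:
  fixes V :: "'a::euclidean_space \<times> 'b::euclidean_space \<Rightarrow> real"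
  assumes V: "(V has_derivative V') (at (x, w))"
  shows "u \<bullet> gradient (\<lambda>\<xi>. V (\<xi>, w)) x + v \<bullet> gradient (\<lambda>\<omega>. V (x, \<omega>)) w = V' (u, v)"
proof -
  have "((\<lambda>\<xi>. (\<xi>, w)) has_derivative (\<lambda>h. (h, 0))) (at x)" "((\<lambda>\<omega>. (x, \<omega>)) has_derivative (\<lambda>h. (0, h))) (at w)"
    by (auto intro!: derivative_eq_intros)
  from inner_gradient[OF has_derivative_compose[OF this(1) V]] inner_gradient[OF has_derivative_compose[OF this(2) V]]
  show ?thesis by (simp flip: linear_add[OF has_derivative_linear[OF V]])
qed

section \<open>Lyapunov exponents\<close>

lemma trajectory_iff_solution: "trajectory f x0 x \<longleftrightarrow> x 0 = x0 \<and> solution f x"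
  by (simp add: trajectory_def solution_def)

lemma forward_invariant_solution:
  assumes "forward_invariant f S" "solution f x" "x 0 \<in> S" "t \<ge> 0"
  shows "x t \<in> S"
  using assms unfolding forward_invariant_def trajectory_iff_solution by blast

lemma C1_on_compound_operator:
  fixes f :: "real^'n::{finite,linorder} \<Rightarrow> real^'n::{finite,linorder}"
  assumes "C1_on S f"
  obtains C :: "real^'n::{finite,linorder} \<Rightarrow> ((real^'m::{finite,linorder}) \<Rightarrow>\<^sub>L (real^'m::{finite,linorder}))"
  where "continuous_on S C" "\<And>x w. x \<in> S \<Longrightarrow> Df_compound k f x *v w = C x w"
proof -
  obtain \<Omega> f' where f: "open \<Omega>" "S \<subseteq> \<Omega>"
    "\<And>x. x \<in> \<Omega> \<Longrightarrow> (f has_derivative blinfun_apply (f' x)) (at x)" "continuous_on \<Omega> f'"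
    using C1_onE[OF assms] by metis
  show thesis
  proof (rule that[of "\<lambda>x. compound_operator k (f' x)"])
    show "continuous_on S (\<lambda>x. compound_operator k (f' x))"
      by (rule bounded_linear.continuous_on[OF bounded_linear_compound_operator
            continuous_on_subset[OF f(4,2)]])
    show "Df_compound k f x *v w = compound_operator k (f' x) w" if "x \<in> S" for x w
      by (rule Df_compound_eq[OF f(3)]) (use f(2) that in blast)
  qed
qed

lemma C2_on_compound_operator:
  fixes f :: "real^'n::{finite,linorder} \<Rightarrow> real^'n::{finite,linorder}"
  assumes "C2_on S f"
  obtains C :: "real^'n::{finite,linorder} \<Rightarrow> ((real^'m::{finite,linorder}) \<Rightarrow>\<^sub>L (real^'m::{finite,linorder}))"
  where "C1_on S C" "\<And>x w. x \<in> S \<Longrightarrow> Df_compound k f x *v w = C x w"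
proof -
  obtain \<Omega> f' where f: "open \<Omega>" "S \<subseteq> \<Omega>"
    "\<forall>x\<in>\<Omega>. (f has_derivative blinfun_apply (f' x)) (at x)" "C1_on \<Omega> f'"
    using assms unfolding C2_on_def by metis
  show thesis
  proof (rule that[of "\<lambda>x. compound_operator k (f' x)"])
    show "C1_on S (\<lambda>x. compound_operator k (f' x))"
      by (rule C1_on_compose[OF C1_on_subset[OF f(4,2)]
            C1_on_bounded_linear[OF bounded_linear_compound_operator, of UNIV]]) simp
    show "Df_compound k f x *v w = compound_operator k (f' x) w" if "x \<in> S" for x w
      by (rule Df_compound_eq) (use f(2,3) that in blast)
  qed
qed

text \<open>
  Because \<open>ln 0 = 0\<close>, a solution reaching \<open>0\<close> would spoil the upper bound on the exponent
  for negative \<open>B\<close>.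
\<close>

lemma compound_solution_nonzero:
  fixes f :: "real^'n::{finite,linorder} \<Rightarrow> real^'n::{finite,linorder}"
    and y0 :: "real^'m::{finite,linorder}"
  assumes C1: "C1_on S f" and inv: "forward_invariant f S" and x: "trajectory f x0 x" "x0 \<in> S"
    and y: "compound_solution k f x y0 y" "y0 \<noteq> 0" and t: "t \<ge> 0"
  shows "y t \<noteq> 0"
proof -
  obtain C :: "real^'n::{finite,linorder} \<Rightarrow> ((real^'m::{finite,linorder}) \<Rightarrow>\<^sub>L (real^'m::{finite,linorder}))"
    where C: "continuous_on S C" "\<And>x w. x \<in> S \<Longrightarrow> Df_compound k f x *v w = C x w"
    using C1_on_compound_operator[OF C1] by blast
  have sol: "solution f x" "x 0 = x0" using x(1) by (auto simp: trajectory_iff_solution)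
  have xS: "x s \<in> S" if "s \<ge> 0" for s
    using forward_invariant_solution[OF inv sol(1)] sol(2) x(2) that by simp
  have "continuous_on {0..t} x" by (rule continuous_on_subset[OF solution_continuous_on[OF sol(1)]]) auto
  then have "continuous_on {0..t} (\<lambda>s. C (x s))"
    by (rule continuous_on_compose2[OF C(1)]) (use xS in auto)
  then have "bounded ((\<lambda>s. C (x s)) ` {0..t})"
    by (intro compact_imp_bounded compact_continuous_image compact_Icc)
  \<comment> \<open>The coefficients may be unbounded along the whole trajectory, so the constant is
    taken on \<open>{0..t}\<close> only.\<close>
  then obtain M where M: "\<And>s. s \<in> {0..t} \<Longrightarrow> norm (C (x s)) \<le> M"
    unfolding bounded_iff by (metis imageI)
  have "norm (y 0) \<le> exp (M * t) * norm (y t)"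
  proof (rule gronwall_norm(2)[where g' = "\<lambda>s. C (x s) (y s)"])
    fix s assume s: "s \<in> {0..t}"
    have "(y has_vector_derivative C (x s) (y s)) (at s within {0..})"
      using y(1) s xS[of s] unfolding compound_solution_def by (auto simp flip: C(2))
    then show "(y has_vector_derivative C (x s) (y s)) (at s within {0..t})"
      by (rule has_vector_derivative_within_subset) auto
    show "norm (C (x s) (y s)) \<le> M * norm (y s)"
      by (rule order_trans[OF norm_blinfun mult_right_mono[OF M[OF s]]]) simp
  qed (use t in auto)
  then show ?thesis using y by (auto simp: compound_solution_def)
qed

lemma leading_exponent_sum_le:
  fixes f :: "real^'n::{finite,linorder} \<Rightarrow> real^'n::{finite,linorder}"
    and V :: "(real^'n::{finite,linorder}) \<times> (real^'m::{finite,linorder}) \<Rightarrow> real"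
  assumes C1: "C1_on S f" and inv: "forward_invariant f S" and x0: "x0 \<in> S"
    and V: "admissible k f S B V"
  shows "leading_exponent_sum TYPE('m) k f x0 \<le> ereal B"
  unfolding leading_exponent_sum_def
proof (rule Sup_least, clarify)
  fix x and y0 :: "real^'m::{finite,linorder}" and y
  assume x: "trajectory f x0 x" and y0: "y0 \<in> sphere 0 1" and y: "compound_solution k f x y0 y"
  have sol: "solution f x" "x 0 = x0" using x by (auto simp: trajectory_iff_solution)
  have xS: "x s \<in> S" if "s \<ge> 0" for s
    using forward_invariant_solution[OF inv sol(1)] sol(2) x0 that by simp
  have y_init: "y 0 = y0" and dy: "\<And>t. t \<ge> 0 \<Longrightarrow> (y has_vector_derivative Df_compound k f (x t) *v y t) (at t within {0..})"
    using y by (auto simp: compound_solution_def)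
  define W where "W t = (x t, exp (- B * t) *\<^sub>R y t)" for t
  obtain \<Omega> V' where \<Omega>: "S \<times> UNIV \<subseteq> \<Omega>"
    and V': "\<And>p. p \<in> \<Omega> \<Longrightarrow> (V has_derivative blinfun_apply (V' p)) (at p)"
    using V C1_onE unfolding admissible_def by metis
  have decr: "V (W t) \<le> V (W 0)" if t: "t \<ge> 0" for t
  proof -
    have "(W has_derivative (\<lambda>h. h *\<^sub>R (f (x s), m_field k f B (x s) (exp (- B * s) *\<^sub>R y s)))) (at s within {0..t})"
      if s: "0 \<le> s" "s \<le> t" for s
    proof -
      have 1: "(x has_vector_derivative f (x s)) (at s within {0..t})"
        by (rule solutionD[OF sol(1)]) (use s in auto)
      have "(y has_vector_derivative Df_compound k f (x s) *v y s) (at s within {0..t})"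
        by (rule has_vector_derivative_within_subset[OF dy]) (use s in auto)
      then have "((\<lambda>s. exp (- B * s) *\<^sub>R y s) has_vector_derivative
          exp (- B * s) *\<^sub>R (Df_compound k f (x s) *v y s) + (- B * exp (- B * s)) *\<^sub>R y s) (at s within {0..t})"
        by (intro has_vector_derivative_scaleR) (auto intro!: derivative_eq_intros)
      moreover have "exp (- B * s) *\<^sub>R (Df_compound k f (x s) *v y s) + (- B * exp (- B * s)) *\<^sub>R y s
          = m_field k f B (x s) (exp (- B * s) *\<^sub>R y s)"
        by (simp add: m_field_def matrix_vector_mult_scaleR)
      ultimately have "(W has_vector_derivative (f (x s), m_field k f B (x s) (exp (- B * s) *\<^sub>R y s))) (at s within {0..t})"
        unfolding W_def[abs_def] using has_vector_derivative_Pair[OF 1] by simp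
      then show ?thesis by (simp add: has_vector_derivative_def)
    qed
    note dW = this
    have "((\<lambda>s. V (W s)) has_derivative
        (\<lambda>h. V' (W s) (h *\<^sub>R (f (x s), m_field k f B (x s) (exp (- B * s) *\<^sub>R y s))))) (at s within {0..t})"
      if s: "0 \<le> s" "s \<le> t" for s
      by (rule has_derivative_compose[OF dW[OF s] V']) (use \<Omega> xS s in \<open>auto simp: W_def\<close>)
    from mvt_very_simple[OF t this] obtain s where s: "s \<in> {0..t}"
      "V (W t) - V (W 0) = V' (W s) (t *\<^sub>R (f (x s), m_field k f B (x s) (exp (- B * s) *\<^sub>R y s)))"
      by auto
    have "(V has_derivative blinfun_apply (V' (W s))) (at (x s, exp (- B * s) *\<^sub>R y s))"
      using V'[of "W s"] \<Omega> xS s by (auto simp: W_def)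
    note grad = inner_gradient_Pair[OF this, of "f (x s)" "m_field k f B (x s) (exp (- B * s) *\<^sub>R y s)"]
    have "x s \<in> S" using xS s(1) by simp
    then have "V' (W s) (f (x s), m_field k f B (x s) (exp (- B * s) *\<^sub>R y s)) \<le> 0"
      using V unfolding admissible_def grad[symmetric] by blast
    then have "V (W t) - V (W 0) \<le> 0"
      unfolding s(2) blinfun.scaleR_right using t by (simp add: mult_nonneg_nonpos)
    then show ?thesis by simp
  qed
  \<comment> \<open>Bounds the rescaled solution for all times; its logarithm disappears after
    division by \<open>t\<close>.\<close>
  define c where "c = sqrt (V (W 0))"
  have VW: "(norm (exp (- B * t) *\<^sub>R y t))\<^sup>2 \<le> V (W t)" if "t \<ge> 0" for t
    using V xS[OF that] unfolding admissible_def W_def by blast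
  have "1 \<le> V (W 0)" using VW[of 0] y0 by (simp add: y_init)
  then have c: "c \<ge> 1" by (simp add: c_def)
  have bound: "ereal (1 / t * ln (norm (y t))) \<le> ereal (ln c / t + B)" if t: "t > 0" for t
  proof -
    have "y0 \<noteq> 0" using y0 by auto
    then have y_pos: "norm (y t) > 0"
      using compound_solution_nonzero[OF C1 inv x x0 y] t by simp
    have "(exp (- B * t) * norm (y t))\<^sup>2 \<le> V (W 0)"
      using VW[of t] decr[of t] t by simp
    then have "exp (- B * t) * norm (y t) \<le> c"
      unfolding c_def by (rule real_le_rsqrt)
    then have "ln (exp (- B * t) * norm (y t)) \<le> ln c"
      using y_pos c by (intro ln_mono) auto
    then have "ln (norm (y t)) \<le> ln c + B * t"
      using y_pos by (simp add: ln_mult)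
    then show ?thesis using t by (simp add: field_simps)
  qed
  have "Limsup at_top (\<lambda>t. ereal (1 / t * ln (norm (y t)))) \<le> Limsup at_top (\<lambda>t. ereal (ln c / t + B))"
    by (rule Limsup_mono[OF eventually_mono[OF eventually_gt_at_top[of 0] bound]])
  also have "\<dots> = ereal B"
  proof (rule lim_imp_Limsup)
    have "((\<lambda>t. ln c / t + B) \<longlongrightarrow> 0 + B) at_top"
      by (intro tendsto_add tendsto_const tendsto_divide_0[OF tendsto_const]
          filterlim_at_top_imp_at_infinity filterlim_ident)
    then show "((\<lambda>t. ereal (ln c / t + B)) \<longlongrightarrow> ereal B) at_top" by simp
  qed simp
  finally show "Limsup at_top (\<lambda>t. ereal (1 / t * ln (norm (y t)))) \<le> ereal B" .
qed

text \<open>A real \<open>B'\<close> strictly between the upper limit and \<open>B\<close> leaves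
  the factor \<open>exp ((B' - B) * t)\<close>, which tends to 0.\<close>

lemma eventually_norm_le_of_exponent:
  fixes y :: "real \<Rightarrow> 'a::real_normed_vector"
  assumes lim: "Limsup at_top (\<lambda>t. ereal (1 / t * ln (norm (y t)))) < ereal B" and "e > 0"
  shows "eventually (\<lambda>t. exp (- B * t) * norm (y t) \<le> e) at_top"
proof -
  obtain B' where B': "Limsup at_top (\<lambda>t. ereal (1 / t * ln (norm (y t)))) < ereal B'" "B' < B"
    using ereal_dense2[OF lim] by auto
  have "filterlim (\<lambda>t. (B' - B) * t) at_bot at_top"
    using B'(2) by (intro filterlim_tendsto_neg_mult_at_bot[OF tendsto_const _ filterlim_ident]) auto
  then have "((\<lambda>t. exp ((B' - B) * t)) \<longlongrightarrow> 0) at_top"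
    by (rule filterlim_compose[OF exp_at_bot])
  then have 1: "eventually (\<lambda>t. exp ((B' - B) * t) < e) at_top"
    using \<open>e > 0\<close> by (rule order_tendstoD(2))
  have 2: "eventually (\<lambda>t. ereal (1 / t * ln (norm (y t))) < ereal B') at_top"
    by (rule Limsup_lessD[OF B'(1)])
  show ?thesis
    using 1 2 eventually_gt_at_top[of 0]
  proof eventually_elim
    case (elim t)
    have "norm (y t) \<le> exp (B' * t)"
    \<comment> \<open>As \<open>ln 0 = 0\<close>, the logarithm says nothing about a zero of
      \<open>y\<close>; there the bound is trivial.\<close>
    proof (cases "y t = 0")
      case False
      have "ln (norm (y t)) \<le> B' * t" using elim by (simp add: field_simps)
      then have "exp (ln (norm (y t))) \<le> exp (B' * t)" by (simp only: exp_le_cancel_iff)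
      then show ?thesis using False by simp
    qed simp
    then have "exp (- B * t) * norm (y t) \<le> exp (- B * t) * exp (B' * t)" by (intro mult_left_mono) auto
    also have "\<dots> = exp ((B' - B) * t)" by (simp add: algebra_simps flip: exp_add)
    finally show ?case using elim by simp
  qed
qed

text \<open>The hypothesis concerns one solution at a time. Uniformity in the initial vector comes
  from a finite basis, uniformity in the base point from compactness.\<close>

lemma quadratic_form_admissible:
  fixes f :: "real^'n::{finite,linorder} \<Rightarrow> real^'n::{finite,linorder}"
  assumes C2: "C2_on S f" and C1: "C1_on S f" and inv: "forward_invariant f S" and S: "compact S"
    and B: "\<And>x0. x0 \<in> S \<Longrightarrow> leading_exponent_sum TYPE('m::{finite,linorder}) k f x0 < ereal B"
  obtains U :: "real^'n::{finite,linorder} \<Rightarrow> real^'m::{finite,linorder}^'m::{finite,linorder}"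
  where "C1_on S U" "admissible k f S B (\<lambda>(x, w). w \<bullet> (U x *v w))"
proof -
  obtain C :: "real^'n::{finite,linorder} \<Rightarrow> ((real^'m::{finite,linorder}) \<Rightarrow>\<^sub>L (real^'m::{finite,linorder}))"
    where C: "C1_on S C" "\<And>x w. x \<in> S \<Longrightarrow> Df_compound k f x *v w = C x w"
    using C2_on_compound_operator[OF C2] by blast
  \<comment> \<open>The shift by \<open>B\<close> turns exponents below \<open>B\<close> into
    decay.\<close>
  define A where "A x = C x + (- B) *\<^sub>R id_blinfun" for x
  have A: "A x w = C x w - B *\<^sub>R w" for x w by (simp add: A_def blinfun.bilinear_simps)
  have "C1_on S A"
    unfolding A_def[abs_def] by (intro C1_on_add C(1) C1_on_const)
  interpret compact_cocycle f A S
  proof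
    show "\<exists>x. solution f x \<and> x 0 = x0" if "x0 \<in> S" for x0
      using inv that unfolding forward_invariant_def trajectory_iff_solution by blast
  qed (use S C1 \<open>C1_on S A\<close> forward_invariant_solution[OF inv] in auto)
  let ?F = "skew_field f A"
  have "\<exists>T\<ge>1. \<forall>w0. norm w0 \<le> 1 \<longrightarrow> (\<exists>z. solution ?F z \<and> z 0 = (x0, w0) \<and> norm (snd (z T)) \<le> 1/4)"
    if x0: "x0 \<in> S" for x0
  proof -
    obtain x where x: "solution f x" "x 0 = x0" using solution_exists[OF x0] by blast
    have xS: "x t \<in> S" if "t \<ge> 0" for t using invariant[OF x(1) _ that] x(2) x0 by simp
    have "\<exists>w. w 0 = b \<and> solution ?F (\<lambda>t. (x t, w t))" for b
      using skew_solution_exists[OF x(1)] x(2) x0 by metis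
    then obtain w where w: "\<And>b. w b 0 = b" "\<And>b. solution ?F (\<lambda>t. (x t, w b t))" by metis
    have dw: "(w b has_vector_derivative A (x t) (w b t)) (at t within {0..})" if "t \<ge> 0" for b t
      using w(2)[of b] that by (simp add: solution_skew_field_iff)
    \<comment> \<open>Vectors in the unit ball have coordinates of modulus at most 1, so basis
      solutions below \<open>e\<close> superpose to at most 1/4.\<close>
    define e where "e = 1 / (4 * real (card (Basis :: (real^'m::{finite,linorder}) set)))"
    have e: "e > 0" by (simp add: e_def)
    have "eventually (\<lambda>t. norm (w b t) \<le> e) at_top" if b: "b \<in> Basis" for b
    proof -
      \<comment> \<open>Undoing the shift recovers a compound solution from the unit vector
        \<open>b\<close>, to which the exponent bound applies.\<close>
      define y where "y t = exp (B * t) *\<^sub>R w b t" for t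
      have "compound_solution k f x b y"
        unfolding compound_solution_def
      proof (intro conjI allI impI)
        show "y 0 = b" by (simp add: y_def w(1))
        fix t :: real assume t: "t \<ge> 0"
        have "(y has_vector_derivative exp (B * t) *\<^sub>R A (x t) (w b t) + (B * exp (B * t)) *\<^sub>R w b t) (at t within {0..})"
          unfolding y_def[abs_def]
          by (intro has_vector_derivative_scaleR dw t) (auto intro!: derivative_eq_intros)
        moreover have "exp (B * t) *\<^sub>R A (x t) (w b t) + (B * exp (B * t)) *\<^sub>R w b t = Df_compound k f (x t) *v y t"
          by (simp add: C(2)[OF xS[OF t]] A y_def blinfun.scaleR_right algebra_simps)
        ultimately show "(y has_vector_derivative Df_compound k f (x t) *v y t) (at t within {0..})" by simp
      qed
      then have "Limsup at_top (\<lambda>t. ereal (1 / t * ln (norm (y t)))) \<le> leading_exponent_sum TYPE('m) k f x0"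
        unfolding leading_exponent_sum_def using x b
        by (intro Sup_upper) (auto simp: trajectory_iff_solution intro!: exI[of _ x] exI[of _ b] exI[of _ y])
      also have "\<dots> < ereal B" by (rule B[OF x0])
      finally have "eventually (\<lambda>t. exp (- B * t) * norm (y t) \<le> e) at_top"
        by (rule eventually_norm_le_of_exponent[OF _ e])
      then show ?thesis by (simp add: y_def flip: mult.assoc exp_add)
    qed
    then have "eventually (\<lambda>t. \<forall>b\<in>Basis. norm (w b t) \<le> e) at_top"
      by (intro eventually_ball_finite) auto
    then have "eventually (\<lambda>t. (\<forall>b\<in>Basis. norm (w b t) \<le> e) \<and> t \<ge> 1) at_top"
      by (intro eventually_conj eventually_ge_at_top)
    then obtain T where T: "T \<ge> 1" "\<And>b. b \<in> Basis \<Longrightarrow> norm (w b T) \<le> e"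
      using eventually_happens'[OF trivial_limit_at_top_linorder] by blast
    show ?thesis
    proof (intro exI[of _ T] conjI allI impI T(1))
      fix w0 :: "real^'m::{finite,linorder}" assume w0: "norm w0 \<le> 1"
      define v where "v t = (\<Sum>b\<in>Basis. (w0 \<bullet> b) *\<^sub>R w b t)" for t
      have "(v has_vector_derivative A (x t) (v t)) (at t within {0..})" if "t \<ge> 0" for t
      proof -
        have "(v has_vector_derivative (\<Sum>b\<in>Basis. (w0 \<bullet> b) *\<^sub>R A (x t) (w b t))) (at t within {0..})"
          unfolding v_def[abs_def]
          by (intro has_vector_derivative_sum bounded_linear.has_vector_derivative[OF bounded_linear_scaleR_right] dw that)
        then show ?thesis by (simp add: v_def blinfun.sum_right blinfun.scaleR_right)
      qed
      then have "solution ?F (\<lambda>t. (x t, v t))" using x by (simp add: solution_skew_field_iff)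
      moreover have "v 0 = w0" by (simp add: v_def w(1) euclidean_representation)
      moreover have "norm (v T) \<le> 1/4"
      proof -
        have "norm (v T) \<le> (\<Sum>b\<in>(Basis :: (real^'m::{finite,linorder}) set). 1 * e)"
          unfolding v_def
        proof (rule sum_norm_le)
          fix b :: "real^'m::{finite,linorder}" assume b: "b \<in> Basis"
          have "\<bar>w0 \<bullet> b\<bar> \<le> 1" using Basis_le_norm[OF b, of w0] w0 by simp
          then show "norm ((w0 \<bullet> b) *\<^sub>R w b T) \<le> 1 * e"
            unfolding norm_scaleR using T(2)[OF b] by (intro mult_mono) auto
        qed
        also have "\<dots> = 1/4" by (simp add: e_def)
        finally show ?thesis .
      qed
      ultimately show "\<exists>z. solution ?F z \<and> z 0 = (x0, w0) \<and> norm (snd (z T)) \<le> 1/4"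
        using x(2) by (intro exI[of _ "\<lambda>t. (x t, v t)"]) simp
    qed
  qed
  from uniform_contraction[OF this] obtain T where "T > 0"
    "\<And>z. solution ?F z \<Longrightarrow> fst (z 0) \<in> S \<Longrightarrow> norm (snd (z T)) \<le> 1/2 * norm (snd (z 0))" by metis
  from euler_lyapunov[OF this] obtain h N where N: "N > 0"
    and EC1: "\<And>i. i \<le> N \<Longrightarrow> C1_on (S \<times> UNIV) (euler_step ?F h ^^ i)"
    and der: "\<And>x w. x \<in> S \<Longrightarrow> \<exists>V'.
      ((\<lambda>p. \<Sum>i<N. (norm (snd ((euler_step ?F h ^^ i) p)))\<^sup>2) has_derivative V') (at (x, w)) \<and>
      V' (?F (x, w)) \<le> 0" by metis
  define W where "W i x w = snd ((euler_step ?F h ^^ i) (x, w))" for i x w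
  \<comment> \<open>The sum of the Gram matrices of the images of the standard basis: each
    \<open>W i x\<close> is linear, so this matrix represents the Lyapunov sum.\<close>
  define U :: "real^'n::{finite,linorder} \<Rightarrow> real^'m::{finite,linorder}^'m::{finite,linorder}"
    where "U x = (\<chi> a b. \<Sum>i<N. W i x (axis a 1) \<bullet> W i x (axis b 1))" for x
  have lin: "linear (W i x)" for i x
    unfolding W_def[abs_def] by (rule linear_snd_euler_skew(1))
  have WC1: "C1_on (S \<times> UNIV) (\<lambda>p. W i (fst p) (snd p))" if "i \<le> N" for i
    unfolding W_def using C1_on_compose[OF EC1[OF that] C1_on_bounded_linear[OF bounded_linear_snd, of UNIV]] by simp
  have WC1': "C1_on S (\<lambda>x. W i x w)" if "i \<le> N" for i w
  proof -
    have "C1_on S (\<lambda>x. (x, w))"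
      by (intro C1_on_Pair C1_on_const C1_on_bounded_linear bounded_linear_ident)
    from C1_on_compose[OF this WC1[OF that]] show ?thesis by (simp add: image_subset_iff)
  qed
  have form: "w \<bullet> (U x *v w) = (\<Sum>i<N. (norm (W i x w))\<^sup>2)" for x w
  proof -
    have W: "W i x w = (\<Sum>a\<in>UNIV. (w $ a) *\<^sub>R W i x (axis a 1))" for i
    proof -
      have "W i x (\<Sum>a\<in>UNIV. (w $ a) *s axis a 1) = (\<Sum>a\<in>UNIV. (w $ a) *\<^sub>R W i x (axis a 1))"
        by (simp add: linear_sum[OF lin] linear_cmul[OF lin] scalar_mult_eq_scaleR)
      then show ?thesis by (simp only: basis_expansion)
    qed
    have "(\<Sum>i<N. (norm (W i x w))\<^sup>2) = (\<Sum>i<N. \<Sum>a\<in>UNIV. \<Sum>b\<in>UNIV. w $ a * w $ b * (W i x (axis a 1) \<bullet> W i x (axis b 1)))"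
      unfolding power2_norm_eq_inner
      by (subst (1 2) W)
        (simp add: inner_sum_left inner_sum_right sum_distrib_left ac_simps inner_commute)
    also have "\<dots> = (\<Sum>a\<in>UNIV. \<Sum>b\<in>UNIV. \<Sum>i<N. w $ a * w $ b * (W i x (axis a 1) \<bullet> W i x (axis b 1)))"
      by (subst sum.swap, rule sum.cong[OF refl], rule sum.swap)
    also have "\<dots> = w \<bullet> (U x *v w)"
      by (simp add: inner_vec_def matrix_vector_mult_def U_def sum_distrib_left sum_distrib_right ac_simps)
    finally show ?thesis by simp
  qed
  show thesis
  proof (rule that[of U])
    show "C1_on S U"
    proof (rule C1_on_componentwise)
      fix b :: "real^'m::{finite,linorder}^'m::{finite,linorder}" assume "b \<in> Basis"
      then obtain i j where b: "\<And>A :: real^'m::{finite,linorder}^'m::{finite,linorder}. A \<bullet> b = A $ i $ j"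
        using Basis_matrixE by blast
      have "C1_on S (\<lambda>x. \<Sum>l<N. W l x (axis i 1) \<bullet> W l x (axis j 1))"
        by (intro C1_on_sum C1_on_bilinear[OF bounded_bilinear_inner] WC1') auto
      then show "C1_on S (\<lambda>x. U x \<bullet> b)" by (simp add: b U_def)
    qed
    show "admissible k f S B (\<lambda>(x, w). w \<bullet> (U x *v w))"
      unfolding admissible_def
    proof (intro conjI ballI allI)
      have "C1_on (S \<times> UNIV) (\<lambda>p. \<Sum>i<N. W i (fst p) (snd p) \<bullet> W i (fst p) (snd p))"
        by (intro C1_on_sum C1_on_bilinear[OF bounded_bilinear_inner] WC1) auto
      then show "C1_on (S \<times> UNIV) (\<lambda>(x, w). w \<bullet> (U x *v w))"
        by (simp add: form case_prod_unfold power2_norm_eq_inner)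
      fix x w assume x: "x \<in> S"
      \<comment> \<open>The zeroth iterate is the identity, so its summand alone gives the lower
        bound.\<close>
      have "(norm w)\<^sup>2 = (norm (W 0 x w))\<^sup>2" by (simp add: W_def)
      also have "\<dots> \<le> (\<Sum>i<N. (norm (W i x w))\<^sup>2)"
        using N by (intro member_le_sum) auto
      finally show "(norm w)\<^sup>2 \<le> (case (x, w) of (x, w) \<Rightarrow> w \<bullet> (U x *v w))" by (simp add: form)
      have V: "(\<lambda>(x, w). w \<bullet> (U x *v w)) = (\<lambda>p. \<Sum>i<N. (norm (snd ((euler_step ?F h ^^ i) p)))\<^sup>2)"
        by (auto simp: form W_def)
      obtain V' where V': "((\<lambda>(x, w). w \<bullet> (U x *v w)) has_derivative V') (at (x, w))" "V' (?F (x, w)) \<le> 0"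
        using der[OF x] unfolding V by blast
      have "?F (x, w) = (f x, m_field k f B x w)"
        by (simp add: skew_field_def m_field_def A C(2)[OF x])
      then show "f x \<bullet> gradient (\<lambda>\<xi>. case (\<xi>, w) of (x, w) \<Rightarrow> w \<bullet> (U x *v w)) x +
          m_field k f B x w \<bullet> gradient (\<lambda>\<omega>. case (x, \<omega>) of (x, w) \<Rightarrow> w \<bullet> (U x *v w)) w \<le> 0"
        using V'(2) unfolding inner_gradient_Pair[OF V'(1)] by simp
    qed
  qed
qed

theorem proposition2p11:
  fixes f :: "real^'n::{finite,linorder} \<Rightarrow> real^'n::{finite,linorder}"
    and S :: "(real^'n::{finite,linorder}) set"
    and k :: nat
  assumes C1: "C1_on S f"
    and inv: "forward_invariant f S"
    and k: "k \<in> {1..CARD('n::{finite,linorder})}"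
    and m: "CARD('m::{finite,linorder}) = CARD('n::{finite,linorder}) choose k"
  shows
    "((\<forall>x0\<in>S. \<forall>x. trajectory f x0 x \<longrightarrow> bounded (x ` {0..})) \<longrightarrow>
        (SUP x0\<in>S. leading_exponent_sum TYPE('m::{finite,linorder}) k f x0)
          \<le> Inf {ereal B | B. \<exists>V :: (real^'n::{finite,linorder}) \<times> (real^'m::{finite,linorder}) \<Rightarrow> real. admissible k f S B V})
     \<and>
     (compact S \<and> C2_on S f \<longrightarrow>
        (SUP x0\<in>S. leading_exponent_sum TYPE('m::{finite,linorder}) k f x0)
          = Inf {ereal B | B. \<exists>V :: (real^'n::{finite,linorder}) \<times> (real^'m::{finite,linorder}) \<Rightarrow> real. admissible k f S B V}
        \<and>
        (SUP x0\<in>S. leading_exponent_sum TYPE('m::{finite,linorder}) k f x0)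
          = Inf {ereal B | B. \<exists>U :: real^'n::{finite,linorder} \<Rightarrow> real^'m::{finite,linorder}^'m::{finite,linorder}.
              C1_on S U \<and> admissible k f S B (\<lambda>(x, w). w \<bullet> (U x *v w))})"
    (is "(_ \<longrightarrow> ?M \<le> ?V) \<and> (_ \<longrightarrow> ?M = ?V \<and> ?M = ?U)")
proof -
  have MV: "?M \<le> ?V"
    by (auto intro!: Inf_greatest SUP_least leading_exponent_sum_le[OF C1 inv])
  have VU: "?V \<le> ?U"
    by (rule Inf_superset_mono) auto
  \<comment> \<open>Closes the cycle of inequalities, hence both equalities. A real \<open>B\<close>
    strictly above \<open>?M\<close> provides the slack, so the infimum is approached without having
    to be attained.\<close>
  have UM: "?U \<le> ?M" if S: "compact S" and C2: "C2_on S f"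
  proof (rule dense_ge)
    fix z assume "?M < z"
    then obtain B where B: "?M < ereal B" "ereal B < z" using ereal_dense2 by blast
    have "leading_exponent_sum TYPE('m) k f x0 < ereal B" if "x0 \<in> S" for x0
      using B(1) SUP_upper[OF that, of "leading_exponent_sum TYPE('m) k f"] by (rule le_less_trans[rotated])
    then obtain U :: "real^'n::{finite,linorder} \<Rightarrow> real^'m::{finite,linorder}^'m::{finite,linorder}"
      where "C1_on S U" "admissible k f S B (\<lambda>(x, w). w \<bullet> (U x *v w))"
      using quadratic_form_admissible[OF C2 C1 inv S] by metis
    then have "?U \<le> ereal B" by (intro Inf_lower) auto
    then show "?U \<le> z" using B(2) by simp
  qed
  show ?thesis
    using MV VU UM by (auto intro: order.antisym order_trans)
qed

end
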